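(* Let $r\ge 3$ be an integer. (i) Every linear equation $a_1x_1+\dots+a_{2m}x_{2m}=0$ with $m\ge 2$ and coefficients $a_i\in\mathbb{Z}\setminus\{0\}$ that has no canceling partition is $r$-uncommon over the integers. (ii) The equation $x+2y-z-2w=0$ is $r$-uncommon over the integers.
   Context: A linear equation $a_1x_1+\dots+a_kx_k=0$ with nonzero integer coefficients has a canceling partition if its coefficients (i.e. the index set $\{1,\dots,k\}$) can be partitioned into pairs $\{i,j\}$ with $a_i+a_j=0$. Write $[n]=\{1,\dots,n\}$. Let $E: a_1x_1+\dots+a_kx_k=0$ be a linear equation with nonzero integer coefficients, and let $r\ge 2$ be an integer. An $r$-coloring of $[n]$ is a map $c:[n]\to\{1,\dots,r\}$; a solution $(x_1,\dots,x_k)\in[n]^k$ of $E$ is monochromatic if $c(x_1)=\dots=c(x_k)$. The equation $E$ is $r$-common over the integers if any $r$-coloring of $[n]$ has at least as many monochromatic solutions asymptotically (as $n\to\infty$) as a uniformly random $r$-coloring; that is, the minimum over all $r$-colorings of $[n]$ of the proportion of solutions of $E$ in $[n]^k$ that are monochromatic is at least $r^{1-k}-o(1)$ as $n\to\infty$. Otherwise $E$ is $r$-uncommon over the integers. *)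

theory Defs
  imports Complex_Main "HOL-Library.FuncSet" "HOL-Library.Disjoint_Sets"
    "HOL-Library.Landau_Symbols"
begin

text \<open>
  The equation \<open>a\<^sub>1 x\<^sub>1 + \<dots> + a\<^sub>k x\<^sub>k = 0\<close> is represented by its list of coefficients, and a
  solution by the list of values of its variables. Indices are shifted to \<open>0, \<dots>, k - 1\<close>.
\<close>

definition solutions :: "int list \<Rightarrow> nat \<Rightarrow> nat list set" where
  "solutions a n = {x. length x = length a \<and> set x \<subseteq> {1..n} \<and>
     (\<Sum>i<length a. a ! i * int (x ! i)) = 0}"

definition has_canceling_partition :: "int list \<Rightarrow> bool" where
  "has_canceling_partition a \<longleftrightarrow>
     (\<exists>P. partition_on {..<length a} P \<and>
        (\<forall>B\<in>P. \<exists>i j. i \<noteq> j \<and> B = {i, j} \<and> a ! i + a ! j = 0))"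

definition colorings :: "nat \<Rightarrow> nat \<Rightarrow> (nat \<Rightarrow> nat) set" where
  "colorings r n = {1..n} \<rightarrow>\<^sub>E {1..r}"

definition monochromatic :: "(nat \<Rightarrow> nat) \<Rightarrow> nat list \<Rightarrow> bool" where
  "monochromatic c x \<longleftrightarrow> (\<forall>i<length x. \<forall>j<length x. c (x ! i) = c (x ! j))"

text \<open>
  If there are no solutions at all, the proportion is \<open>0 / 0 = 0\<close>. For large \<open>n\<close> this happens
  only when all coefficients have the same sign; by this convention such an equation
  is uncommon.
\<close>

definition mono_proportion :: "int list \<Rightarrow> nat \<Rightarrow> (nat \<Rightarrow> nat) \<Rightarrow> real" where
  "mono_proportion a n c =
     real (card {x \<in> solutions a n. monochromatic c x}) / real (card (solutions a n))"

definition min_mono_proportion :: "nat \<Rightarrow> int list \<Rightarrow> nat \<Rightarrow> real" where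
  "min_mono_proportion r a n = Min (mono_proportion a n ` colorings r n)"

definition common :: "nat \<Rightarrow> int list \<Rightarrow> bool" where
  "common r a \<longleftrightarrow>
     (\<exists>e :: nat \<Rightarrow> real. e \<in> o(\<lambda>_. 1) \<and>
        (\<forall>\<^sub>F n in sequentially.
           min_mono_proportion r a n \<ge> real r powi (1 - int (length a)) - e n))"

abbreviation uncommon :: "nat \<Rightarrow> int list \<Rightarrow> bool" where
  "uncommon r a \<equiv> \<not> common r a"

end

theory Submission
  imports Defs
begin

text \<open>
  A random coloring in which \<open>v\<close> gets color \<open>i\<close> with probability \<open>g\<^sub>i(v)\<close> shows that it suffices to find
  functions \<open>g\<^sub>i \<ge> 0\<close> with sum 1 and \<open>\<Sum>\<^sub>i \<Sum>\<^sub>x g\<^sub>i(x\<^sub>1) \<cdots> g\<^sub>i(x\<^sub>k) \<le> (r\<^bsup>1-k\<^esup> - \<delta>) N\<close>,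
  where \<open>x\<close> runs through the \<open>N\<close> solutions. In both parts \<open>g\<^sub>1 = 1/r + f\<close>, \<open>g\<^sub>2 = 1/r - f\<close> and the other \<open>g\<^sub>i\<close> are \<open>1/r\<close>.

  (i) Take \<open>f(v) = \<epsilon> \<Sum>\<^sub>c cos(c\<theta>v + \<phi>(c))\<close> over \<open>c = \<plusminus>a\<^sub>1, \<dots>, \<plusminus>a\<^sub>k\<close> with an odd phase \<open>\<phi>\<close>.
  A character \<open>x \<mapsto> e\<^bsup>i\<theta>(c\<^sub>1x\<^sub>1 + \<dots> + c\<^sub>kx\<^sub>k)\<^esup>\<close> averages to \<open>o(1)\<close> over the solutions unless \<open>c\<close> is
  proportional to \<open>a\<close>, that is \<open>c = 0\<close> or \<open>c = \<plusminus>a\<close>. The last two contribute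
  \<open>2 \<epsilon>\<^bsup>k\<^esup> cos(\<phi>(a\<^sub>1) + \<dots> + \<phi>(a\<^sub>k))\<close>, for both signs of \<open>f\<close> since \<open>k\<close> is even. Without a canceling
  partition some \<open>b\<close> and \<open>-b\<close> occur with different multiplicities among the coefficients, so a suitable
  \<open>\<phi>(b)\<close> makes the sum of the phases \<open>\<pi>\<close>.

  (ii) Here no character helps, and the gain comes from the boundary of \<open>[n]\<close>: \<open>f\<close> is a step function on
  12 equal blocks. The number of solutions in a given quadruple of blocks is computed exactly
  when the block length is a power of 2, by halving the blocks.
\<close>

section \<open>Random colorings\<close>

lemma finite_solutions [simp]: "finite (solutions a n)"
  by (rule finite_subset[OF _ finite_lists_length_eq[of "{1..n}" "length a"]])
     (auto simp: solutions_def)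

lemma length_solution: "x \<in> solutions a n \<Longrightarrow> length x = length a"
  by (simp add: solutions_def)

lemma solution_nth: "x \<in> solutions a n \<Longrightarrow> i < length a \<Longrightarrow> x ! i \<in> {1..n}"
  unfolding solutions_def by (metis (mono_tags, lifting) mem_Collect_eq nth_mem subsetD)

lemma solution_sum: "x \<in> solutions a n \<Longrightarrow> (\<Sum>i<length a. a ! i * int (x ! i)) = 0"
  by (simp add: solutions_def)

lemma solutionI:
  assumes "length x = length a" "\<And>i. i < length a \<Longrightarrow> x ! i \<in> {1..n}"
    and "(\<Sum>i<length a. a ! i * int (x ! i)) = 0"
  shows "x \<in> solutions a n"
  using assms by (force simp: solutions_def in_set_conv_nth)

text \<open>Upper bounds for sets of solutions all come from here: each coordinate that the others
  determine saves a factor \<open>n\<close>.\<close>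

lemma card_le_if_inj_on_restrict:
  assumes T: "T \<subseteq> solutions a n" and I: "I \<subseteq> {..<length a}"
    and inj: "\<And>x y. x \<in> T \<Longrightarrow> y \<in> T \<Longrightarrow> (\<And>i. i \<in> I \<Longrightarrow> x ! i = y ! i) \<Longrightarrow> x = y"
  shows "card T \<le> n ^ card I"
proof -
  have fin: "finite I" using I finite_subset by blast
  have "inj_on (\<lambda>x. restrict (nth x) I) T"
    using inj by (intro inj_onI) (metis restrict_apply')
  moreover have "(\<lambda>x. restrict (nth x) I) ` T \<subseteq> I \<rightarrow>\<^sub>E {1..n}"
    using T I by (auto simp: PiE_def dest!: solution_nth[OF subsetD[OF T]])
  ultimately have "card T \<le> card (I \<rightarrow>\<^sub>E {1..n})"
    using fin by (intro card_inj_on_le) (auto intro: finite_PiE)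
  then show ?thesis using fin by (simp add: card_PiE)
qed

text \<open>The coefficient at \<open>l\<close> is nonzero, so the equation recovers the entry at
  \<open>l\<close> from the others.\<close>

lemma solution_eqI:
  assumes x: "x \<in> solutions a n" and y: "y \<in> solutions a n" and a0: "0 \<notin> set a"
    and l: "l < length a" and eq: "\<And>i. i < length a \<Longrightarrow> i \<noteq> l \<Longrightarrow> x ! i = y ! i"
  shows "x = y"
proof -
  have "(\<Sum>i<length a. a ! i * int (x ! i)) = a ! l * int (x ! l)
      + (\<Sum>i\<in>{..<length a}-{l}. a ! i * int (x ! i))"
    using l by (subst sum.remove[of _ l]) auto
  moreover have "(\<Sum>i<length a. a ! i * int (y ! i)) = a ! l * int (y ! l)
      + (\<Sum>i\<in>{..<length a}-{l}. a ! i * int (y ! i))"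
    using l by (subst sum.remove[of _ l]) auto
  moreover have "(\<Sum>i\<in>{..<length a}-{l}. a ! i * int (x ! i))
      = (\<Sum>i\<in>{..<length a}-{l}. a ! i * int (y ! i))"
    using eq by (intro sum.cong) auto
  ultimately have "a ! l * int (x ! l) = a ! l * int (y ! l)"
    using solution_sum[OF x] solution_sum[OF y] by linarith
  moreover have "a ! l \<noteq> 0" using a0 l nth_mem by metis
  ultimately have "x ! l = y ! l" by simp
  with eq show ?thesis
    by (metis length_solution[OF x] length_solution[OF y] nth_equalityI)
qed

lemma card_solutions_fixed_coordinate:
  assumes a0: "0 \<notin> set a" and i: "i < length a" and k: "length a \<ge> 2"
  shows "card {x \<in> solutions a n. x ! i = v} \<le> n ^ (length a - 2)"
proof -
  obtain l where l: "l < length a" "l \<noteq> i"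
    using k that[of 0] that[of 1] by (cases "i = 0") linarith+
  have "card ({..<length a} - {i, l}) = length a - 2"
    using i l by (subst card_Diff_subset) auto
  moreover have "card {x \<in> solutions a n. x ! i = v} \<le> n ^ card ({..<length a} - {i, l})"
  proof (rule card_le_if_inj_on_restrict[of _ a])
    fix x y assume xy: "x \<in> {x \<in> solutions a n. x ! i = v}" "y \<in> {x \<in> solutions a n. x ! i = v}"
      and eq: "\<And>j. j \<in> {..<length a} - {i, l} \<Longrightarrow> x ! j = y ! j"
    show "x = y"
      using xy eq
        by (intro solution_eqI[OF _ _ a0 l(1)]) (auto, metis DiffI lessThan_iff empty_iff insert_iff)
  qed auto
  ultimately show ?thesis by simp
qed

text \<open>The entry recovered from the equation has to lie at a third index \<open>l\<close>: with
  \<open>x ! i = x ! j\<close>, solving for the common value would divide by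
  \<open>a ! i + a ! j\<close>, which may vanish. For \<open>x - y = 0\<close> all \<open>n\<close>
  solutions have equal entries.\<close>

lemma card_solutions_repeated_coordinate:
  assumes a0: "0 \<notin> set a" and i: "i < length a" "j < length a" "i \<noteq> j" and k: "length a \<ge> 3"
  shows "card {x \<in> solutions a n. x ! i = x ! j} \<le> n ^ (length a - 2)"
proof -
  have "\<not> {..<length a} \<subseteq> {i, j}"
    using k card_mono[of "{i, j}" "{..<length a}"] i by auto
  then obtain l where l: "l < length a" "l \<noteq> i" "l \<noteq> j"
    by auto
  have "card ({..<length a} - {i, l}) = length a - 2"
    using i l by (subst card_Diff_subset) auto
  moreover have "card {x \<in> solutions a n. x ! i = x ! j} \<le> n ^ card ({..<length a} - {i, l})"
  proof (rule card_le_if_inj_on_restrict[of _ a])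
    fix x y assume xy: "x \<in> {x \<in> solutions a n. x ! i = x ! j}"
      "y \<in> {x \<in> solutions a n. x ! i = x ! j}"
      and eq: "\<And>j. j \<in> {..<length a} - {i, l} \<Longrightarrow> x ! j = y ! j"
    have "x ! j = y ! j" using eq[of j] i l by auto
    with xy have "x ! i = y ! i" by simp
    then show "x = y"
      using xy eq
        by (intro solution_eqI[OF _ _ a0 l(1)]) (auto, metis DiffI lessThan_iff empty_iff insert_iff)
  qed auto
  ultimately show ?thesis by simp
qed

lemma card_nondistinct_solutions:
  assumes a0: "0 \<notin> set a" and k: "length a \<ge> 3"
  shows "card {x \<in> solutions a n. \<not> distinct x} \<le> length a ^ 2 * n ^ (length a - 2)"
proof -
  let ?J = "{(i, j). i < length a \<and> j < length a \<and> i \<noteq> j}"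
  have J: "?J \<subseteq> {..<length a} \<times> {..<length a}" by auto
  then have finJ: "finite ?J" by (rule finite_subset) auto
  have cJ: "card ?J \<le> length a ^ 2"
    using card_mono[OF _ J] by (simp add: power2_eq_square)
  have "{x \<in> solutions a n. \<not> distinct x} \<subseteq> (\<Union>p\<in>?J. {x \<in> solutions a n. x ! fst p = x ! snd p})"
    by (fastforce simp: distinct_conv_nth length_solution)
  then have "card {x \<in> solutions a n. \<not> distinct x}
      \<le> card (\<Union>p\<in>?J. {x \<in> solutions a n. x ! fst p = x ! snd p})"
    using finJ by (intro card_mono) auto
  also have "\<dots> \<le> (\<Sum>p\<in>?J. card {x \<in> solutions a n. x ! fst p = x ! snd p})"
    by (rule card_UN_le[OF finJ])
  also have "\<dots> \<le> (\<Sum>p\<in>?J. n ^ (length a - 2))"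
    using card_solutions_repeated_coordinate[OF a0 _ _ _ k] by (intro sum_mono) auto
  also have "\<dots> \<le> length a ^ 2 * n ^ (length a - 2)"
    using cJ by simp
  finally show ?thesis .
qed

text \<open>
  First moment method. Only for a solution with distinct entries is
  \<open>\<Sum>i. \<Prod>j. g i (x ! j)\<close> the probability of being monochromatic; the others go into the error term.
\<close>

lemma exists_coloring_few_monochromatic:
  fixes g :: "nat \<Rightarrow> nat \<Rightarrow> real"
  assumes a0: "0 \<notin> set a" and k: "length a \<ge> 3"
    and nonneg: "\<And>i v. i \<in> {1..r} \<Longrightarrow> v \<in> {1..n} \<Longrightarrow> g i v \<ge> 0"
    and sum1: "\<And>v. v \<in> {1..n} \<Longrightarrow> (\<Sum>i\<in>{1..r}. g i v) = 1"
  shows "\<exists>c\<in>colorings r n. real (card {x \<in> solutions a n. monochromatic c x}) \<le>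
           (\<Sum>x\<in>solutions a n. \<Sum>i\<in>{1..r}. \<Prod>j<length a. g i (x ! j))
             + real (length a) ^ 2 * real n ^ (length a - 2)"
    (is "\<exists>c\<in>_. _ \<le> ?B")
proof -
  \<comment> \<open>\<open>w c\<close> is the probability of \<open>c\<close> when the points are
    colored independently.\<close>
  define w where "w c = (\<Prod>v\<in>{1..n}. g (c v) v)" for c
  have fin: "finite (colorings r n)"
    unfolding colorings_def by (intro finite_PiE) auto
  have wsum: "(\<Sum>c\<in>colorings r n. w c) = 1"
    unfolding w_def colorings_def using sum1 by (subst prod_sum_PiE[symmetric]) auto
  have w0: "w c \<ge> 0" if "c \<in> colorings r n" for c
    using that nonneg PiE_mem unfolding w_def colorings_def by (intro prod_nonneg ballI) blast
  have colour: "(\<Sum>c\<in>colorings r n. w c * of_bool (\<forall>v\<in>set x. c v = i)) = (\<Prod>j<length a. g i (x ! j))"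
    if x: "x \<in> solutions a n" "distinct x" and i: "i \<in> {1..r}" for x i
  proof -
    have sub: "set x \<subseteq> {1..n}" using x by (simp add: solutions_def)
    \<comment> \<open>Both the weight and the indicator of the event are products over all points,
      so the sum over colorings becomes a product of sums over colors.\<close>
    have "w c * of_bool (\<forall>v\<in>set x. c v = i)
        = (\<Prod>v\<in>{1..n}. g (c v) v * of_bool (v \<in> set x \<longrightarrow> c v = i))" for c
    proof -
      have "(\<Prod>v\<in>{1..n}. of_bool (v \<in> set x \<longrightarrow> c v = i) :: real) = of_bool (\<forall>v\<in>set x. c v = i)"
      proof (cases "\<forall>v\<in>set x. c v = i")
        case False
        then obtain v where v: "v \<in> set x" "c v \<noteq> i" by auto
        with sub have "v \<in> {1..n}" by auto
        then have "(\<Prod>v\<in>{1..n}. of_bool (v \<in> set x \<longrightarrow> c v = i) :: real) = 0"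
          using v by (intro prod_zero) (auto intro!: bexI[of _ v])
        with False show ?thesis by simp
      qed (auto intro!: prod.neutral)
      then show ?thesis unfolding w_def by (simp add: prod.distrib)
    qed
    then have "(\<Sum>c\<in>colorings r n. w c * of_bool (\<forall>v\<in>set x. c v = i))
        = (\<Prod>v\<in>{1..n}. \<Sum>l\<in>{1..r}. g l v * of_bool (v \<in> set x \<longrightarrow> l = i))"
      unfolding colorings_def by (subst prod_sum_PiE) auto
    \<comment> \<open>A point outside \<open>x\<close> contributes the sum of all its probabilities,
      which is 1.\<close>
    also have "\<dots> = (\<Prod>v\<in>{1..n}. if v \<in> set x then g i v else 1)"
    proof (rule prod.cong[OF refl])
      fix v assume v: "v \<in> {1..n}"
      show "(\<Sum>l\<in>{1..r}. g l v * of_bool (v \<in> set x \<longrightarrow> l = i)) = (if v \<in> set x then g i v else 1)"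
        using i sum1[OF v]
          by (auto simp: of_bool_def if_distrib[of "(*) _"] sum.delta cong: if_cong)
    qed
    also have "\<dots> = (\<Prod>v\<in>set x. g i v)"
      using sub by (simp add: prod.If_cases Int_absorb1)
    \<comment> \<open>Distinctness enters here: each point of \<open>set x\<close> occurs at exactly
      one position.\<close>
    also have "\<dots> = (\<Prod>j<length a. g i (x ! j))"
      using x(2) by (intro prod.reindex_bij_betw[symmetric])
        (auto simp: length_solution[OF x(1), symmetric] intro: bij_betw_nth)
    finally show ?thesis .
  qed
  have mono: "of_bool (monochromatic c x) = (\<Sum>i\<in>{1..r}. of_bool (\<forall>v\<in>set x. c v = i) :: real)"
    if x: "x \<in> solutions a n" and c: "c \<in> colorings r n" for x c
  proof -
    have len: "length x \<ge> 3" using k x by (simp add: length_solution)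
    then have x0: "x ! 0 \<in> set x" by (intro nth_mem) auto
    then have cx: "c (x ! 0) \<in> {1..r}"
      using x c by (auto simp: solutions_def colorings_def)
    have "monochromatic c x \<longleftrightarrow> (\<forall>v\<in>set x. c v = c (x ! 0))"
      unfolding monochromatic_def all_set_conv_all_nth using len by (metis not_numeral_le_zero gr0I)
    then have "of_bool (\<forall>v\<in>set x. c v = i)
        = (if i = c (x ! 0) then of_bool (monochromatic c x) else 0 :: real)" for i
      using x0 by auto
    then have "(\<Sum>i\<in>{1..r}. of_bool (\<forall>v\<in>set x. c v = i) :: real)
        = (\<Sum>i\<in>{1..r}. if i = c (x ! 0) then of_bool (monochromatic c x) else 0)"
      by (simp only:)
    then show ?thesis using cx by simp
  qed
  have prod_ge0: "(\<Sum>i\<in>{1..r}. \<Prod>j<length a. g i (x ! j)) \<ge> 0" if "x \<in> solutions a n" for x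
    using solution_nth[OF that] nonneg by (intro sum_nonneg prod_nonneg) auto
  have "(\<Sum>c\<in>colorings r n. w c * real (card {x \<in> solutions a n. monochromatic c x}))
      = (\<Sum>c\<in>colorings r n. \<Sum>x\<in>solutions a n. w c * of_bool (monochromatic c x))"
    by (simp add: sum_distrib_left[symmetric] Int_def)
  also have "\<dots> = (\<Sum>x\<in>solutions a n. \<Sum>c\<in>colorings r n. w c * of_bool (monochromatic c x))"
    by (rule sum.swap)
  also have "\<dots> \<le> (\<Sum>x\<in>solutions a n. (\<Sum>i\<in>{1..r}. \<Prod>j<length a. g i (x ! j)) + of_bool (\<not> distinct x))"
  proof (rule sum_mono)
    fix x assume x: "x \<in> solutions a n"
    show "(\<Sum>c\<in>colorings r n. w c * of_bool (monochromatic c x))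
        \<le> (\<Sum>i\<in>{1..r}. \<Prod>j<length a. g i (x ! j)) + of_bool (\<not> distinct x)"
    proof (cases "distinct x")
      case True
      have "(\<Sum>c\<in>colorings r n. w c * of_bool (monochromatic c x))
          = (\<Sum>c\<in>colorings r n. \<Sum>i\<in>{1..r}. w c * of_bool (\<forall>v\<in>set x. c v = i))"
        by (intro sum.cong refl) (simp only: mono[OF x] sum_distrib_left)
      also have "\<dots> = (\<Sum>i\<in>{1..r}. \<Prod>j<length a. g i (x ! j))"
        by (subst sum.swap) (intro sum.cong refl colour[OF x True])
      finally show ?thesis using True by simp
    next
      case False
      have "(\<Sum>c\<in>colorings r n. w c * of_bool (monochromatic c x)) \<le> (\<Sum>c\<in>colorings r n. w c)"
        using w0 by (intro sum_mono) auto
      then show ?thesis using False wsum prod_ge0[OF x] by simp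
    qed
  qed
  also have "\<dots> = (\<Sum>x\<in>solutions a n. \<Sum>i\<in>{1..r}. \<Prod>j<length a. g i (x ! j))
      + real (card {x \<in> solutions a n. \<not> distinct x})"
    by (simp add: sum.distrib Int_def)
  also have "\<dots> \<le> ?B"
  proof -
    have "real (card {x \<in> solutions a n. \<not> distinct x}) \<le> real (length a ^ 2 * n ^ (length a - 2))"
      using card_nondistinct_solutions[OF a0 k] by (rule of_nat_mono)
    then show ?thesis by simp
  qed
  finally have le: "(\<Sum>c\<in>colorings r n. w c * real (card {x \<in> solutions a n. monochromatic c x}))
      \<le> ?B" .
  show ?thesis
  proof (rule ccontr)
    assume "\<not> ?thesis"
    then have gt: "real (card {x \<in> solutions a n. monochromatic c x}) > ?B"
      if "c \<in> colorings r n" for c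
      using that by (auto simp: not_le)
    \<comment> \<open>A coloring of positive weight makes the comparison of the averages
      strict.\<close>
    obtain c where c: "c \<in> colorings r n" "w c > 0"
      using wsum w0 by (metis less_eq_real_def sum.neutral zero_neq_one)
    have "(\<Sum>c\<in>colorings r n. w c * ?B)
        < (\<Sum>c\<in>colorings r n. w c * real (card {x \<in> solutions a n. monochromatic c x}))"
    proof (rule sum_strict_mono_ex1[OF fin])
      show "\<forall>c\<in>colorings r n. w c * ?B \<le> w c * real (card {x \<in> solutions a n. monochromatic c x})"
        by (intro ballI mult_left_mono less_imp_le[OF gt] w0)
      show "\<exists>c\<in>colorings r n. w c * ?B < w c * real (card {x \<in> solutions a n. monochromatic c x})"
        using c by (intro bexI[of _ c] mult_strict_left_mono gt)
    qed
    with le show False by (simp add: sum_distrib_right[symmetric] wsum)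
  qed
qed

section \<open>A criterion for uncommonness\<close>

text \<open>Relative to at least \<open>c * n ^ (length a - 1)\<close> solutions, all error terms
  are \<open>O(1 / n)\<close>, so a fixed gain \<delta> survives. Being common concerns all large
  \<open>n\<close>, so weights \<open>g\<close> for infinitely many \<open>n\<close> refute it; part
  (ii) relies on this freedom.\<close>

lemma uncommonI:
  fixes \<delta> c C :: real
  assumes a0: "0 \<notin> set a" and k: "length a \<ge> 3" and pos: "\<delta> > 0" "c > 0" "C \<ge> 0"
    and many: "\<forall>\<^sub>F n in sequentially. c * real n ^ (length a - 1) \<le> real (card (solutions a n))"
    and few: "\<exists>\<^sub>F n in sequentially. \<exists>g. (\<forall>i\<in>{1..r}. \<forall>v\<in>{1..n}. 0 \<le> g i v)
        \<and> (\<forall>v\<in>{1..n}. (\<Sum>i\<in>{1..r}. g i v) = 1)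
        \<and> (\<Sum>x\<in>solutions a n. \<Sum>i\<in>{1..r}. \<Prod>j<length a. g i (x ! j))
            \<le> (real r powi (1 - int (length a)) - \<delta>) * real (card (solutions a n))
              + C * real n ^ (length a - 2)"
  shows "uncommon r a"
proof
  define R where "R = real r powi (1 - int (length a))"
  define C' where "C' = C + real (length a) ^ 2"
  have C': "C' \<ge> 0" using pos by (simp add: C'_def)
  assume "common r a"
  then obtain e where e: "e \<in> o(\<lambda>_. 1 :: real)"
    and ev: "\<forall>\<^sub>F n in sequentially. min_mono_proportion r a n \<ge> R - e n"
    by (auto simp: common_def R_def)
  from e have "(\<lambda>n. e n / 1) \<longlonglongrightarrow> 0" by (rule smalloD_tendsto)
  then have e_small: "\<forall>\<^sub>F n in sequentially. e n < \<delta> / 2"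
    using pos by (intro order_tendstoD) auto
  have "(\<lambda>n. C' / c * inverse (real n)) \<longlonglongrightarrow> C' / c * 0"
    by (intro tendsto_intros LIMSEQ_inverse_real_of_nat[THEN LIMSEQ_imp_Suc])
  from order_tendstoD(2)[OF this, of "\<delta> / 2"]
  have err_small: "\<forall>\<^sub>F n in sequentially. C' / c * inverse (real n) < \<delta> / 2"
    using pos by simp
  have "\<exists>\<^sub>F n in sequentially. False"
    using few
  proof (rule frequently_rev_mp)
    show "\<forall>\<^sub>F n in sequentially. (\<exists>g. (\<forall>i\<in>{1..r}. \<forall>v\<in>{1..n}. 0 \<le> g i v)
        \<and> (\<forall>v\<in>{1..n}. (\<Sum>i\<in>{1..r}. g i v) = 1)
        \<and> (\<Sum>x\<in>solutions a n. \<Sum>i\<in>{1..r}. \<Prod>j<length a. g i (x ! j))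
            \<le> (real r powi (1 - int (length a)) - \<delta>) * real (card (solutions a n))
              + C * real n ^ (length a - 2)) \<longrightarrow> False"
      using ev e_small err_small many eventually_gt_at_top[of 0]
    proof (eventually_elim, intro impI, elim exE conjE)
      fix n :: nat and g :: "nat \<Rightarrow> nat \<Rightarrow> real"
      define N where "N = real (card (solutions a n))"
      assume min: "min_mono_proportion r a n \<ge> R - e n" and en: "e n < \<delta> / 2"
        and err: "C' / c * inverse (real n) < \<delta> / 2"
        and "c * real n ^ (length a - 1) \<le> real (card (solutions a n))" and n: "n > 0"
        and g: "\<forall>i\<in>{1..r}. \<forall>v\<in>{1..n}. 0 \<le> g i v" "\<forall>v\<in>{1..n}. (\<Sum>i\<in>{1..r}. g i v) = 1"
          "(\<Sum>x\<in>solutions a n. \<Sum>i\<in>{1..r}. \<Prod>j<length a. g i (x ! j))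
            \<le> (real r powi (1 - int (length a)) - \<delta>) * real (card (solutions a n))
              + C * real n ^ (length a - 2)"
      then have N: "c * real n ^ (length a - 1) \<le> N" by (simp add: N_def)
      have pow: "real n ^ (length a - 1) = real n ^ (length a - 2) * real n"
      proof -
        have "length a - 1 = Suc (length a - 2)" using k by simp
        then show ?thesis by simp
      qed
      have npos: "c * real n ^ (length a - 1) > 0" using pos n by simp
      with N have Npos: "N > 0" by linarith
      obtain \<chi> where \<chi>: "\<chi> \<in> colorings r n"
        "real (card {x \<in> solutions a n. monochromatic \<chi> x})
          \<le> (\<Sum>x\<in>solutions a n. \<Sum>i\<in>{1..r}. \<Prod>j<length a. g i (x ! j))
             + real (length a) ^ 2 * real n ^ (length a - 2)"
        using exists_coloring_few_monochromatic[OF a0 k, of r n g] g by blast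
      have "mono_proportion a n \<chi> \<le> ((R - \<delta>) * N + C' * real n ^ (length a - 2)) / N"
        unfolding mono_proportion_def N_def[symmetric]
        using \<chi>(2) g(3) Npos
          by (intro divide_right_mono) (simp_all add: R_def N_def C'_def algebra_simps)
      also have "\<dots> = R - \<delta> + C' * (real n ^ (length a - 2) / N)"
        using Npos by (simp add: field_simps)
      also have "C' * (real n ^ (length a - 2) / N)
          \<le> C' * (real n ^ (length a - 2) / (c * real n ^ (length a - 1)))"
        using N npos C' by (intro mult_left_mono divide_left_mono) auto
      also have "real n ^ (length a - 2) / (c * real n ^ (length a - 1)) = 1 / c * inverse (real n)"
        using n pos unfolding pow by (simp add: field_simps)
      finally have "mono_proportion a n \<chi> \<le> R - \<delta> + C' / c * inverse (real n)"
        by simp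
      moreover have "min_mono_proportion r a n \<le> mono_proportion a n \<chi>"
        unfolding min_mono_proportion_def
        using \<chi>(1) by (intro Min_le) (auto simp: colorings_def intro!: finite_imageI finite_PiE)
      ultimately show False using min en err by linarith
    qed
  qed
  then show False by simp
qed

section \<open>A lower bound for the number of solutions\<close>

text \<open>A solution with positive entries is scaled into the interior of the box and then moved
  by a family of integer solutions with \<open>length a - 1\<close> free parameters, small enough to
  stay inside.\<close>

lemma card_solutions_ge:
  fixes a :: "int list"
  assumes p: "p < length a" "a ! p > 0" and q: "q < length a" "a ! q < 0"
  obtains c :: real where "c > 0"
    "\<forall>\<^sub>F n in sequentially. c * real n ^ (length a - 1) \<le> real (card (solutions a n))"
proof -
  define A where "A = (\<Sum>j<length a. \<bar>a ! j\<bar>)"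
  define P where "P = (\<Sum>j<length a. max (a ! j) 0)"
  define Q where "Q = (\<Sum>j<length a. max (- (a ! j)) 0)"
  \<comment> \<open>Weight \<open>Q\<close> on the positive and \<open>P\<close> on the other
    coefficients makes the equation read \<open>P * Q - Q * P = 0\<close>.\<close>
  define u where "u j = (if a ! j > 0 then Q else P)" for j
  \<comment> \<open>The entries of \<open>A * L * u\<close> lie between \<open>A * L\<close> and
    \<open>A * A * L\<close>, and the perturbation is at most \<open>A * (L - 1)\<close>. Hence
    \<open>A * (A + 1) * L \<le> n\<close> keeps everything in \<open>{1..n}\<close>.\<close>
  define K where "K = nat (A * (A + 1))"
  define I where "I = {..<length a} - {p}"
  have I: "finite I" "card I = length a - 1" "p \<notin> I" "{..<length a} = insert p I"
    using p by (auto simp: I_def)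
  have PA: "P \<le> A" "Q \<le> A" unfolding P_def Q_def A_def by (intro sum_mono; simp)+
  have "max (a ! p) 0 \<le> P" "max (- (a ! q)) 0 \<le> Q"
    unfolding P_def Q_def using p q by (intro member_le_sum; simp)+
  then have PQ: "P \<ge> 1" "Q \<ge> 1" using p q by auto
  then have A1: "A \<ge> 1" using PA by linarith
  then have K: "K > 0" "int K = A * (A + 1)" by (auto simp: K_def)
  have u: "1 \<le> u j" "u j \<le> A" for j using PQ PA by (auto simp: u_def)
  have "(\<Sum>j<length a. a ! j * u j) = (\<Sum>j<length a. max (a ! j) 0 * Q - max (- (a ! j)) 0 * P)"
    by (intro sum.cong) (auto simp: u_def)
  also have "\<dots> = 0" by (simp add: sum_subtractf flip: sum_distrib_right P_def Q_def)
  finally have usum: "(\<Sum>j<length a. a ! j * u j) = 0" .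
  have bound: "L ^ (length a - 1) \<le> card (solutions a n)" if L: "L = n div K" "L > 0" for n L
  proof -
    \<comment> \<open>Coordinate \<open>i\<close> in \<open>I\<close> moves by
      \<open>t i * a ! p\<close>, and coordinate \<open>p\<close> compensates for all these
      moves.\<close>
    define X where "X t j = (if j = p then A * int L * u p - (\<Sum>i\<in>I. int (t i) * a ! i)
                             else A * int L * u j + int (t j) * a ! p)" for t :: "nat \<Rightarrow> nat" and j
    define F where "F t = map (\<lambda>j. nat (X t j)) [0..<length a]" for t
    have KL: "A * (A + 1) * int L \<le> int n"
    proof -
      have "K * L \<le> n" using L by simp
      then have "int K * int L \<le> int n" by (metis of_nat_le_iff of_nat_mult)
      then show ?thesis by (simp add: K)
    qed
    have X: "1 \<le> X t j" "X t j \<le> int n" if t: "t \<in> I \<rightarrow>\<^sub>E {..<L}" and j: "j < length a" for t j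
    proof -
      have tL: "int (t i) \<le> int L - 1" if "i \<in> I" for i using t that PiE_mem[of t I "\<lambda>_. {..<L}" i]
        by fastforce
      have dev: "\<bar>X t j - A * int L * u j\<bar> \<le> A * (int L - 1)"
      proof (cases "j = p")
        case True
        have "\<bar>\<Sum>i\<in>I. int (t i) * a ! i\<bar> \<le> (\<Sum>i\<in>I. \<bar>int (t i) * a ! i\<bar>)" by (rule sum_abs)
        also have "\<dots> \<le> (\<Sum>i\<in>I. (int L - 1) * \<bar>a ! i\<bar>)"
          using tL by (intro sum_mono) (auto simp: abs_mult intro!: mult_right_mono)
        also have "\<dots> = (int L - 1) * (\<Sum>i\<in>I. \<bar>a ! i\<bar>)" by (simp add: sum_distrib_left)
        also have "\<dots> \<le> (int L - 1) * A"
          using L unfolding A_def I_def by (intro mult_left_mono sum_mono2) auto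
        finally show ?thesis using True by (simp add: X_def mult.commute)
      next
        case False
        then have "j \<in> I" using j by (simp add: I_def)
        moreover have "\<bar>a ! p\<bar> \<le> A" unfolding A_def using p by (intro member_le_sum) auto
        ultimately have "int (t j) * \<bar>a ! p\<bar> \<le> (int L - 1) * A"
          using tL[of j] L by (intro mult_mono) auto
        then show ?thesis using False by (simp add: X_def abs_mult mult.commute)
      qed
      have lo: "A * int L * 1 \<le> A * int L * u j" and hi: "A * int L * u j \<le> A * int L * A"
        using u[of j] A1 by (intro mult_left_mono; simp)+
      have "\<bar>X t j - A * int L * u j\<bar> \<le> A * int L - A"
        using dev by (simp add: right_diff_distrib)
      moreover have "A * (A + 1) * int L = A * int L * A + A * int L" by (simp add: algebra_simps)
      ultimately show "1 \<le> X t j" "X t j \<le> int n"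
        using lo hi KL A1 unfolding mult_1_right by linarith+
    qed
    have "F ` (I \<rightarrow>\<^sub>E {..<L}) \<subseteq> solutions a n"
    proof (rule image_subsetI, rule solutionI)
      fix t assume t: "t \<in> I \<rightarrow>\<^sub>E {..<L}"
      have F: "int (F t ! j) = X t j" if "j < length a" for j
        using X(1)[OF t that] that by (simp add: F_def)
      show "F t ! j \<in> {1..n}" if "j < length a" for j
        using X[OF t that] F[OF that] by auto
      have "(\<Sum>j<length a. a ! j * int (F t ! j)) = (\<Sum>j<length a. a ! j * X t j)"
        using F by simp
      also have "\<dots> = (\<Sum>j<length a. a ! j * (A * int L * u j))
          + (\<Sum>j<length a. a ! j * (X t j - A * int L * u j))"
        by (simp flip: sum.distrib add: algebra_simps)
      also have "(\<Sum>j<length a. a ! j * (A * int L * u j)) = A * int L * (\<Sum>j<length a. a ! j * u j)"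
        by (simp add: sum_distrib_left mult_ac)
      also have "(\<Sum>j<length a. a ! j * (X t j - A * int L * u j))
          = - a ! p * (\<Sum>i\<in>I. int (t i) * a ! i) + (\<Sum>j\<in>I. a ! j * (int (t j) * a ! p))"
      proof -
        have "(\<Sum>j\<in>I. a ! j * (X t j - A * int L * u j)) = (\<Sum>j\<in>I. a ! j * (int (t j) * a ! p))"
          using I(3) by (intro sum.cong) (auto simp: X_def)
        moreover have "a ! p * (X t p - A * int L * u p) = - a ! p * (\<Sum>i\<in>I. int (t i) * a ! i)"
          by (simp add: X_def)
        ultimately show ?thesis
          unfolding I(4) sum.insert[OF I(1) I(3)] by (simp only:)
      qed
      also have "\<dots> = 0" by (simp add: sum_distrib_left sum_negf mult_ac)
      finally show "(\<Sum>j<length a. a ! j * int (F t ! j)) = 0" by (simp add: usum)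
    qed (simp add: F_def)
    moreover have "inj_on F (I \<rightarrow>\<^sub>E {..<L})"
    proof (rule inj_onI)
      fix s t assume s: "s \<in> I \<rightarrow>\<^sub>E {..<L}" and t: "t \<in> I \<rightarrow>\<^sub>E {..<L}" and eq: "F s = F t"
      have "s j = t j" if j: "j \<in> I" for j
      proof -
        have jl: "j < length a" "j \<noteq> p" using j by (auto simp: I_def)
        have "F s ! j = F t ! j" using eq by simp
        then have "nat (X s j) = nat (X t j)" using jl by (simp add: F_def)
        then have "X s j = X t j" using X(1)[OF s jl(1)] X(1)[OF t jl(1)] by linarith
        then show ?thesis using jl p by (simp add: X_def)
      qed
      then show "s = t" using s t by (intro PiE_ext)
    qed
    ultimately have "card (I \<rightarrow>\<^sub>E {..<L}) \<le> card (solutions a n)"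
      by (intro card_inj_on_le) auto
    then show ?thesis using I by (simp add: card_PiE)
  qed
  show ?thesis
  \<comment> \<open>The constant comes from \<open>n < K * (L + 1) \<le> 2 * K * L\<close> for
    \<open>L = n div K \<ge> 1\<close>.\<close>
  proof (rule that[of "(1 / (2 * real K)) ^ (length a - 1)"])
    show "\<forall>\<^sub>F n in sequentially. (1 / (2 * real K)) ^ (length a - 1) * real n ^ (length a - 1)
        \<le> real (card (solutions a n))"
      using eventually_ge_at_top[of K]
    proof eventually_elim
      case (elim n)
      define L where "L = n div K"
      have L: "L > 0" using elim K by (simp add: L_def div_greater_zero_iff)
      have "n < K * (L + 1)"
        unfolding L_def using K
          by (metis add.commute dividend_less_times_div mult_Suc_right plus_1_eq_Suc)
      also have "\<dots> \<le> K * (2 * L)" using L by (intro mult_left_mono) auto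
      finally have "real n \<le> real (K * (2 * L))" by (simp only: of_nat_le_iff)
      then have "1 / (2 * real K) * real n \<le> real L" using K by (simp add: field_simps)
      then have "(1 / (2 * real K) * real n) ^ (length a - 1) \<le> real L ^ (length a - 1)"
        by (intro power_mono) auto
      also have "\<dots> \<le> real (card (solutions a n))"
        using bound[OF L_def L] by (metis of_nat_le_iff of_nat_power)
      finally show ?case by (simp only: power_mult_distrib)
    qed
  qed (use K in auto)
qed

text \<open>Entries are positive, so there are no solutions and the proportion takes its default
  value 0, which is below the positive random value.\<close>

lemma uncommon_if_same_sign:
  assumes k: "length a > 0" and r: "r > 0"
    and sign: "(\<forall>j<length a. a ! j > 0) \<or> (\<forall>j<length a. a ! j < 0)"
  shows "uncommon r a"
proof
  assume "common r a"
  then obtain e where e: "e \<in> o(\<lambda>_. 1 :: real)"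
    and ev: "\<forall>\<^sub>F n in sequentially. min_mono_proportion r a n \<ge> real r powi (1 - int (length a)) - e n"
    by (auto simp: common_def)
  have empty: "solutions a n = {}" for n
  proof (rule ccontr)
    assume "solutions a n \<noteq> {}"
    then obtain x where x: "x \<in> solutions a n" by blast
    have x1: "int (x ! j) > 0" if "j < length a" for j using solution_nth[OF x that] by simp
    have ne: "{..<length a} \<noteq> {}" using k by auto
    from sign show False
    proof
      assume "\<forall>j<length a. a ! j > 0"
      then have "(\<Sum>j<length a. a ! j * int (x ! j)) > 0"
        using x1 ne by (intro sum_pos) auto
      then show False using solution_sum[OF x] by simp
    next
      assume "\<forall>j<length a. a ! j < 0"
      then have "(\<Sum>j<length a. - (a ! j * int (x ! j))) > 0"
        using x1 ne by (intro sum_pos) (auto simp: mult_neg_pos)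
      then show False using solution_sum[OF x] by (simp add: sum_negf)
    qed
  qed
  have "mono_proportion a n ` colorings r n = {0}" for n
  proof -
    have "colorings r n \<noteq> {}" using r by (auto simp: colorings_def PiE_eq_empty_iff)
    then show ?thesis by (auto simp: mono_proportion_def empty)
  qed
  then have min0: "min_mono_proportion r a n = 0" for n
    by (simp add: min_mono_proportion_def)
  have "(\<lambda>n. e n / 1) \<longlonglongrightarrow> 0" using e by (rule smalloD_tendsto)
  then have "\<forall>\<^sub>F n in sequentially. e n < real r powi (1 - int (length a))"
    using r by (intro order_tendstoD) auto
  with ev have "\<forall>\<^sub>F n in sequentially. False"
    by eventually_elim (simp add: min0)
  then show False by simp
qed

section \<open>Characters on the set of solutions\<close>

text \<open>
  Translating by the integer solution \<open>v = a\<^sub>j e\<^sub>i - a\<^sub>i e\<^sub>j\<close> moves only \<open>O(n\<^bsup>k-2\<^esup>)\<close> of the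
  solutions out of the box and multiplies the character by a constant different from 1, so its sum
  over the solutions is of lower order.
\<close>

lemma card_solutions_leave_box:
  fixes d :: int
  assumes a0: "0 \<notin> set a" and i: "i < length a" and k: "length a \<ge> 2"
  shows "card {x \<in> solutions a n. int (x ! i) + d \<notin> {1..int n}} \<le> nat \<bar>d\<bar> * n ^ (length a - 2)"
proof -
  \<comment> \<open>Only the top \<open>d\<close> values can leave the box for positive
    \<open>d\<close>, and only the bottom \<open>- d\<close> values otherwise. If \<open>d\<close>
    exceeds \<open>n\<close>, truncated subtraction gives \<open>{1..n}\<close>, which still has at
    most \<open>d\<close> elements.\<close>
  define V where "V = (if d > 0 then {n - nat d + 1..n} else {1..nat (- d)})"
  have V: "finite V" "card V \<le> nat \<bar>d\<bar>" by (auto simp: V_def)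
  have "{x \<in> solutions a n. int (x ! i) + d \<notin> {1..int n}} \<subseteq> (\<Union>v\<in>V. {x \<in> solutions a n. x ! i = v})"
  proof (intro subsetI)
    fix x assume x: "x \<in> {x \<in> solutions a n. int (x ! i) + d \<notin> {1..int n}}"
    then have "x ! i \<in> {1..n}" using i solution_nth by blast
    with x have "x ! i \<in> V" by (auto simp: V_def)
    with x show "x \<in> (\<Union>v\<in>V. {x \<in> solutions a n. x ! i = v})" by blast
  qed
  then have "card {x \<in> solutions a n. int (x ! i) + d \<notin> {1..int n}}
      \<le> card (\<Union>v\<in>V. {x \<in> solutions a n. x ! i = v})"
    using V by (intro card_mono) auto
  also have "\<dots> \<le> (\<Sum>v\<in>V. card {x \<in> solutions a n. x ! i = v})" by (rule card_UN_le[OF V(1)])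
  also have "\<dots> \<le> (\<Sum>v\<in>V. n ^ (length a - 2))"
    using card_solutions_fixed_coordinate[OF a0 i k] by (intro sum_mono) auto
  also have "\<dots> \<le> nat \<bar>d\<bar> * n ^ (length a - 2)" using V by simp
  finally show ?thesis .
qed

section \<open>Translations and characters\<close>

text \<open>\<gamma> is the frequency vector of a character. \<open>lincomb (nth a)\<close> is the
  left side of the equation, so it vanishes on solutions.\<close>

definition lincomb :: "(nat \<Rightarrow> int) \<Rightarrow> nat list \<Rightarrow> int" where
  "lincomb \<gamma> x = (\<Sum>l<length x. \<gamma> l * int (x ! l))"

text \<open>\<open>nat\<close> truncates negative entries to 0, so this is a translation only where
  the moved entries stay nonnegative.\<close>

definition translate :: "int list \<Rightarrow> nat \<Rightarrow> nat \<Rightarrow> nat list \<Rightarrow> nat list" where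
  "translate a i j x = x[i := nat (int (x ! i) + a ! j), j := nat (int (x ! j) - a ! i)]"

text \<open>For \<open>\<gamma> = nth a\<close> the increment is 0, so solutions that stay in the
  box go to solutions. For other \<gamma> it determines the factor by which the character
  changes.\<close>

lemma lincomb_translate:
  assumes "length x = length a" "i < length a" "j < length a" "i \<noteq> j"
    and "int (x ! i) + a ! j \<ge> 0" "int (x ! j) - a ! i \<ge> 0"
  shows "lincomb \<gamma> (translate a i j x) = lincomb \<gamma> x + (a ! j * \<gamma> i - a ! i * \<gamma> j)"
proof -
  have "lincomb \<gamma> y = \<gamma> i * int (y ! i) + \<gamma> j * int (y ! j)
      + (\<Sum>l\<in>{..<length a} - {i, j}. \<gamma> l * int (y ! l))" if "length y = length a" for y
  proof -
    have "{..<length a} = insert i (insert j ({..<length a} - {i, j}))" using assms by auto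
    then have "lincomb \<gamma> y = (\<Sum>l\<in>insert i (insert j ({..<length a} - {i, j})). \<gamma> l * int (y ! l))"
      using that by (simp add: lincomb_def)
    then show ?thesis using assms(4) by simp
  qed
  from this[of x] this[of "translate a i j x"] assms show ?thesis
    by (simp add: translate_def algebra_simps)
qed

lemma sum_character_solutions:
  assumes a0: "0 \<notin> set a" and ij: "i < length a" "j < length a" "i \<noteq> j"
    and ne: "cis (\<theta> * of_int (a ! j * \<gamma> i - a ! i * \<gamma> j)) \<noteq> 1"
  shows "\<exists>C. \<forall>n. norm (\<Sum>x\<in>solutions a n. cis (\<theta> * of_int (lincomb \<gamma> x)))
      \<le> C * real n ^ (length a - 2)"
proof -
  define D where "D = a ! j * \<gamma> i - a ! i * \<gamma> j"
  define \<chi> where "\<chi> x = cis (\<theta> * of_int (lincomb \<gamma> x))" for x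
  define M where "M = real (2 * (nat \<bar>a ! j\<bar> + nat \<bar>a ! i\<bar>))"
  have k: "length a \<ge> 2" using ij by linarith
  have lina: "lincomb (nth a) x = 0" if "x \<in> solutions a n" for x n
    using solution_sum[OF that] length_solution[OF that] by (simp add: lincomb_def)
  have "norm (\<Sum>x\<in>solutions a n. \<chi> x)
      \<le> (M / norm (cis (\<theta> * of_int D) - 1)) * real n ^ (length a - 2)" for n
  proof -
    define S where "S = solutions a n"
    \<comment> \<open>\<open>A\<close> holds the solutions that translation keeps in the box,
      \<open>B\<close> those that the reverse translation keeps in it. Translation is a bijection
      from \<open>A\<close> to \<open>B\<close>.\<close>
    define A
      where "A = {x \<in> S. int (x ! i) + a ! j \<in> {1..int n} \<and> int (x ! j) - a ! i \<in> {1..int n}}"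
    define B
      where "B = {x \<in> S. int (x ! i) - a ! j \<in> {1..int n} \<and> int (x ! j) + a ! i \<in> {1..int n}}"
    have AB: "A \<subseteq> S" "B \<subseteq> S" "finite S" by (auto simp: A_def B_def S_def)
    have cA: "real (card (S - A)) \<le> M / 2 * real n ^ (length a - 2)"
     and cB: "real (card (S - B)) \<le> M / 2 * real n ^ (length a - 2)"
    proof -
      have "card (S - A)
          \<le> card ({x \<in> solutions a n. int (x ! i) + a ! j \<notin> {1..int n}} \<union> {x \<in> solutions a n. int (x ! j) + (- a ! i) \<notin> {1..int n}})"
        by (intro card_mono) (auto simp: A_def S_def)
      also have "\<dots> \<le> nat \<bar>a ! j\<bar> * n ^ (length a - 2) + nat \<bar>- a ! i\<bar> * n ^ (length a - 2)"
        by (intro order.trans[OF card_Un_le] add_mono card_solutions_leave_box a0 ij k)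
      finally have "real (card (S - A))
          \<le> real (nat \<bar>a ! j\<bar> * n ^ (length a - 2) + nat \<bar>- a ! i\<bar> * n ^ (length a - 2))"
        by (rule of_nat_mono)
      then show "real (card (S - A)) \<le> M / 2 * real n ^ (length a - 2)"
        by (simp add: M_def algebra_simps)
      have "card (S - B)
          \<le> card ({x \<in> solutions a n. int (x ! i) + (- a ! j) \<notin> {1..int n}} \<union> {x \<in> solutions a n. int (x ! j) + a ! i \<notin> {1..int n}})"
        by (intro card_mono) (auto simp: B_def S_def)
      also have "\<dots> \<le> nat \<bar>- a ! j\<bar> * n ^ (length a - 2) + nat \<bar>a ! i\<bar> * n ^ (length a - 2)"
        by (intro order.trans[OF card_Un_le] add_mono card_solutions_leave_box a0 ij k)
      finally have "real (card (S - B))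
          \<le> real (nat \<bar>- a ! j\<bar> * n ^ (length a - 2) + nat \<bar>a ! i\<bar> * n ^ (length a - 2))"
        by (rule of_nat_mono)
      then show "real (card (S - B)) \<le> M / 2 * real n ^ (length a - 2)"
        by (simp add: M_def algebra_simps)
    qed
    have trS: "translate a i j x \<in> B" if x: "x \<in> A" for x
    proof -
      have xS: "x \<in> solutions a n" using x by (simp add: A_def S_def)
      note len = length_solution[OF xS]
      have "lincomb (nth a) (translate a i j x) = 0"
        using x len ij lina[OF xS] by (subst lincomb_translate) (auto simp: A_def)
      then have "translate a i j x \<in> solutions a n"
        using x ij len solution_nth[OF xS]
        by (intro solutionI) (auto simp: A_def translate_def nth_list_update lincomb_def)
      then show ?thesis using x ij len solution_nth[OF xS]
        by (auto simp: A_def B_def S_def translate_def nth_list_update)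
    qed
    have trB: "x[i := nat (int (x ! i) - a ! j), j := nat (int (x ! j) + a ! i)] \<in> A"
      if x: "x \<in> B" for x
    proof -
      let ?y = "x[i := nat (int (x ! i) - a ! j), j := nat (int (x ! j) + a ! i)]"
      have xS: "x \<in> solutions a n" using x by (simp add: B_def S_def)
      note len = length_solution[OF xS]
      have "translate a i j ?y = x"
        using x ij len
          by (auto simp: translate_def B_def list_update_swap intro!: nth_equalityI simp: nth_list_update)
      then have "lincomb (nth a) ?y = 0"
        using lincomb_translate[of ?y a i j "nth a"] x ij len lina[OF xS] by (auto simp: B_def)
      then have "?y \<in> solutions a n"
        using x ij len solution_nth[OF xS]
        by (intro solutionI) (auto simp: B_def nth_list_update lincomb_def)
      then show ?thesis using x ij len solution_nth[OF xS]
        by (auto simp: A_def B_def S_def nth_list_update)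
    qed
    have "(\<Sum>x\<in>A. cis (\<theta> * of_int D) * \<chi> x) = (\<Sum>x\<in>B. \<chi> x)"
    proof (rule sum.reindex_bij_witness[of _ "\<lambda>x. x[i := nat (int (x ! i) - a ! j), j := nat (int (x ! j) + a ! i)]" "translate a i j"])
      fix x assume x: "x \<in> A"
      then have len: "length x = length a" by (auto simp: A_def S_def length_solution)
      show "(translate a i j x)[i := nat (int (translate a i j x ! i) - a ! j), j := nat (int (translate a i j x ! j) + a ! i)] = x"
        using x ij len
          by (auto simp: translate_def A_def intro!: nth_equalityI simp: nth_list_update)
      show "\<chi> (translate a i j x) = cis (\<theta> * of_int D) * \<chi> x"
        using x ij len unfolding \<chi>_def
        by (subst lincomb_translate) (auto simp: A_def D_def cis_mult algebra_simps)
    next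
      fix x assume x: "x \<in> B"
      then have len: "length x = length a" by (auto simp: B_def S_def length_solution)
      show "translate a i j (x[i := nat (int (x ! i) - a ! j), j := nat (int (x ! j) + a ! i)]) = x"
        using x ij len
          by (auto simp: translate_def B_def intro!: nth_equalityI simp: nth_list_update)
    qed (use trS trB in auto)
    then have shift: "cis (\<theta> * of_int D) * (\<Sum>x\<in>A. \<chi> x) = (\<Sum>x\<in>B. \<chi> x)"
      by (simp add: sum_distrib_left)
    note splitA = sum.subset_diff[OF AB(1,3), of \<chi>] and splitB = sum.subset_diff[OF AB(2,3), of \<chi>]
    have small: "norm (\<Sum>x\<in>S - U. \<chi> x) \<le> real (card (S - U))" for U
      using sum_norm_le[of "S - U" \<chi> "\<lambda>_. 1"] by (simp add: \<chi>_def)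
    \<comment> \<open>The sums over \<open>A\<close> and \<open>B\<close> differ by the factor
      \<open>cis (\<theta> * D)\<close>. Comparing both with the sum over \<open>S\<close> leaves
      only boundary terms.\<close>
    have "cis (\<theta> * of_int D) * (\<Sum>x\<in>S. \<chi> x) = cis (\<theta> * of_int D) * (\<Sum>x\<in>S - A. \<chi> x) + (\<Sum>x\<in>B. \<chi> x)"
      unfolding splitA distrib_left shift by (rule refl)
    then have "(cis (\<theta> * of_int D) - 1) * (\<Sum>x\<in>S. \<chi> x)
        = cis (\<theta> * of_int D) * (\<Sum>x\<in>S - A. \<chi> x) - (\<Sum>x\<in>S - B. \<chi> x)"
      using splitB unfolding left_diff_distrib by simp
    then have "norm (cis (\<theta> * of_int D) - 1) * norm (\<Sum>x\<in>S. \<chi> x)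
        = norm (cis (\<theta> * of_int D) * (\<Sum>x\<in>S - A. \<chi> x) - (\<Sum>x\<in>S - B. \<chi> x))"
      by (simp flip: norm_mult)
    also have "\<dots> \<le> norm (cis (\<theta> * of_int D) * (\<Sum>x\<in>S - A. \<chi> x)) + norm (\<Sum>x\<in>S - B. \<chi> x)"
      by (rule norm_triangle_ineq4)
    also have "\<dots> \<le> real (card (S - A)) + real (card (S - B))"
      using small by (simp add: norm_mult add_mono)
    also have "\<dots> \<le> M * real n ^ (length a - 2)" using cA cB by linarith
    finally show ?thesis using ne unfolding S_def D_def[symmetric]
      by (simp add: field_simps)
  qed
  then show ?thesis unfolding \<chi>_def by blast
qed

section \<open>Equations of even length without canceling partition\<close>

text \<open>For each \<open>b > 0\<close> a bijection from the indices with coefficient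
  \<open>b\<close> to those with \<open>- b\<close> forms the pairs. They cover all indices because
  no coefficient is 0.\<close>

lemma has_canceling_partition_if_balanced:
  assumes a0: "0 \<notin> set a"
    and bal: "\<And>b. b > 0 \<Longrightarrow> card {i. i < length a \<and> a ! i = b} = card {i. i < length a \<and> a ! i = - b}"
  shows "has_canceling_partition a"
proof -
  define I where "I b = {i. i < length a \<and> a ! i = b}" for b
  have "\<exists>g. bij_betw g (I b) (I (- b))" if "b > 0" for b
    using bal[OF that] unfolding I_def by (intro finite_same_card_bij) auto
  then obtain g where g: "\<And>b. b > 0 \<Longrightarrow> bij_betw (g b) (I b) (I (- b))" by metis
  define P where "P = (\<lambda>i. {i, g (a ! i) i}) ` {i. i < length a \<and> a ! i > 0}"
  have gI: "g (a ! i) i < length a" "a ! g (a ! i) i = - (a ! i)" if "i < length a"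
    "a ! i > 0" for i
    using bij_betwE[OF g[OF that(2)]] that by (auto simp: I_def)
  have ginj: "i = j" if "i < length a" "a ! i > 0" "j < length a" "a ! j > 0"
    "g (a ! i) i = g (a ! j) j" for i j
  proof -
    have eq: "a ! i = a ! j" using gI[OF that(1,2)] gI[OF that(3,4)] that(5) by simp
    have "inj_on (g (a ! i)) (I (a ! i))" using g[OF that(2)] by (simp add: bij_betw_def)
    then show ?thesis using that eq by (auto simp: I_def inj_on_def)
  qed
  have cover: "\<exists>i. i < length a \<and> a ! i > 0 \<and> j \<in> {i, g (a ! i) i}" if j: "j < length a" for j
  proof (cases "a ! j > 0")
    case False
    have "a ! j \<noteq> 0" using a0 j nth_mem by metis
    then have pos: "- (a ! j) > 0" using False by simp
    have "j \<in> g (- (a ! j)) ` I (- (a ! j))"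
      using bij_betw_imp_surj_on[OF g[OF pos]] j by (simp add: I_def)
    then obtain i where "i \<in> I (- (a ! j))" "j = g (- (a ! j)) i" by blast
    then show ?thesis using pos by (intro exI[of _ i]) (auto simp: I_def)
  qed (use j in auto)
  have "partition_on {..<length a} P"
  proof (rule partition_onI)
    show "\<Union> P = {..<length a}" using cover gI by (fastforce simp: P_def)
    show "{} \<notin> P" by (auto simp: P_def)
    fix p q assume pq: "p \<in> P" "q \<in> P" "p \<noteq> q"
    then obtain i j where i: "i < length a" "a ! i > 0" "p = {i, g (a ! i) i}"
      and j: "j < length a" "a ! j > 0" "q = {j, g (a ! j) j}" by (auto simp: P_def)
    have "i \<noteq> j" using pq i j by auto
    moreover have "g (a ! i) i \<noteq> g (a ! j) j" using ginj i j \<open>i \<noteq> j\<close> by blast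
    moreover have "i \<noteq> g (a ! j) j" "j \<noteq> g (a ! i) i" using gI i j by force+
    ultimately show "disjnt p q" using i j by (auto simp: disjnt_def)
  qed
  moreover have "\<forall>B\<in>P. \<exists>i j. i \<noteq> j \<and> B = {i, j} \<and> a ! i + a ! j = 0"
  proof
    fix B assume "B \<in> P"
    then obtain i where i: "i < length a" "a ! i > 0" "B = {i, g (a ! i) i}" by (auto simp: P_def)
    then show "\<exists>i j. i \<noteq> j \<and> B = {i, j} \<and> a ! i + a ! j = 0"
      using gI[OF i(1,2)] by (intro exI[of _ i] exI[of _ "g (a ! i) i"]) auto
  qed
  ultimately show ?thesis unfolding has_canceling_partition_def by blast
qed

text \<open>Here \<gamma> is a multiple of \<open>a\<close> by some \<lambda>. If \<lambda> is
  nonzero, an index with the largest \<open>\<bar>a ! p\<bar>\<close> gives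
  \<open>\<bar>\<lambda>\<bar> \<le> 1\<close>, and one with the smallest gives
  \<open>\<bar>\<lambda>\<bar> \<ge> 1\<close>.\<close>

lemma proportional_coefficients_rigid:
  fixes a :: "int list" and \<gamma> :: "nat \<Rightarrow> int"
  assumes a0: "0 \<notin> set a" and k: "length a > 0"
    and mem: "\<And>j. j < length a \<Longrightarrow> \<gamma> j \<in> insert 0 (set a \<union> uminus ` set a)"
    and cross: "\<And>i j. i < length a \<Longrightarrow> j < length a \<Longrightarrow> a ! j * \<gamma> i = a ! i * \<gamma> j"
  shows "(\<forall>j<length a. \<gamma> j = 0) \<or> (\<forall>j<length a. \<gamma> j = a ! j) \<or> (\<forall>j<length a. \<gamma> j = - (a ! j))"
proof -
  define A where "A = (\<lambda>j. \<bar>a ! j\<bar>) ` {..<length a}"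
  have A: "finite A" "A \<noteq> {}" using k by (auto simp: A_def)
  obtain p where p: "p < length a" "\<bar>a ! p\<bar> = Max A" using Max_in[OF A] by (auto simp: A_def)
  obtain q where q: "q < length a" "\<bar>a ! q\<bar> = Min A" using Min_in[OF A] by (auto simp: A_def)
  have max: "\<bar>a ! j\<bar> \<le> \<bar>a ! p\<bar>" and min: "\<bar>a ! q\<bar> \<le> \<bar>a ! j\<bar>" if "j < length a" for j
    using that A by (auto simp: p q A_def)
  have nz: "a ! j \<noteq> 0" if "j < length a" for j using a0 nth_mem[OF that] by auto
  have abs: "\<exists>l<length a. \<bar>\<gamma> j\<bar> = \<bar>a ! l\<bar>" if "j < length a" "\<gamma> j \<noteq> 0" for j
    using mem[OF that(1)] that(2) by (force simp: in_set_conv_nth)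
  show ?thesis
  proof (cases "\<gamma> p = 0")
    case True
    then show ?thesis using cross[OF _ p(1)] nz[OF p(1)] by simp
  next
    case False
    have "\<gamma> q \<noteq> 0" using cross[OF p(1) q(1)] nz[OF q(1)] False by auto
    then have "\<bar>a ! q\<bar> * \<bar>a ! p\<bar> \<le> \<bar>\<gamma> q\<bar> * \<bar>a ! p\<bar>"
      using abs[OF q(1)] min by (intro mult_right_mono) auto
    also have "\<dots> = \<bar>a ! q\<bar> * \<bar>\<gamma> p\<bar>"
      using cross[OF p(1) q(1)] by (simp flip: abs_mult add: mult.commute)
    finally have "\<bar>a ! p\<bar> \<le> \<bar>\<gamma> p\<bar>" using nz[OF q(1)] by simp
    moreover have "\<bar>\<gamma> p\<bar> \<le> \<bar>a ! p\<bar>" using abs[OF p(1) False] max by auto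
    ultimately have "\<gamma> p = a ! p \<or> \<gamma> p = - (a ! p)" by linarith
    then show ?thesis
    proof
      assume eq: "\<gamma> p = a ! p"
      have "\<gamma> j = a ! j" if "j < length a" for j
        using cross[OF that p(1)] nz[OF p(1)] by (simp add: eq)
      then show ?thesis by blast
    next
      assume eq: "\<gamma> p = - (a ! p)"
      have "a ! p * \<gamma> j = a ! p * (- (a ! j))" if "j < length a" for j
        using cross[OF that p(1)] by (simp add: eq)
      then have "\<gamma> j = - (a ! j)" if "j < length a" for j
        using that nz[OF p(1)] by (metis mult_left_cancel)
      then show ?thesis by blast
    qed
  qed
qed

lemma cis_neq_1:
  assumes "\<bar>y\<bar> \<le> 1" "y \<noteq> 0"
  shows "cis y \<noteq> 1"
proof
  assume "cis y = 1"
  then have "sin y = 0" by (simp add: complex_eq_iff)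
  moreover have "sin \<bar>y\<bar> > 0" using assms pi_ge_two by (intro sin_gt_zero) auto
  ultimately show False by (auto simp: abs_if split: if_splits)
qed

lemma cis_sum: "finite A \<Longrightarrow> cis (\<Sum>j\<in>A. f j) = (\<Prod>j\<in>A. cis (f j))"
  by (induction A rule: finite_induct) (auto simp flip: cis_mult)

text \<open>Expanding the product over the variables gives one character for each choice of
  frequencies. Three choices carry the main term and the gain; all others are of lower order by
  \<open>sum_character_solutions\<close>.\<close>

lemma uncommon_if_no_canceling_partition:
  assumes a0: "0 \<notin> set a" and k: "length a \<ge> 3" and even: "even (length a)" and r: "r \<ge> 2"
    and nocancel: "\<not> has_canceling_partition a"
  shows "uncommon r a"
proof (cases "(\<forall>j<length a. a ! j > 0) \<or> (\<forall>j<length a. a ! j < 0)")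
  case True
  then show ?thesis using k r by (intro uncommon_if_same_sign) auto
next
  case mixed: False
  have nz: "a ! j \<noteq> 0" if "j < length a" for j using a0 nth_mem[OF that] by auto
  obtain p q where "p < length a" "a ! p > 0" "q < length a" "a ! q < 0"
    using mixed nz by (metis linorder_less_linear)
  then obtain c where c: "c > 0"
    "\<forall>\<^sub>F n in sequentially. c * real n ^ (length a - 1) \<le> real (card (solutions a n))"
    by (rule card_solutions_ge)
  obtain b where b: "b > 0"
    "card {i. i < length a \<and> a ! i = b} \<noteq> card {i. i < length a \<and> a ! i = - b}"
    using has_canceling_partition_if_balanced[OF a0] nocancel by blast
  define d
    where "d
        = real (card {i. i < length a \<and> a ! i = b}) - real (card {i. i < length a \<and> a ! i = - b})"
  have d: "d \<noteq> 0" using b(2) by (simp add: d_def)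
  \<comment> \<open>The phase sits only at \<open>b\<close> and \<open>- b\<close>; dividing by the
    difference \<open>d\<close> of their multiplicities makes the total phase \<pi>.\<close>
  define \<phi> where "\<phi> x = pi / d * (of_bool (x = b) - of_bool (x = - b))" for x :: int
  have odd: "\<phi> (- x) = - \<phi> x" for x by (auto simp: \<phi>_def)
  have "(\<Sum>j<length a. \<phi> (a ! j))
      = pi / d * ((\<Sum>j<length a. of_bool (a ! j = b)) - (\<Sum>j<length a. of_bool (a ! j = - b)))"
    unfolding \<phi>_def by (simp only: sum_subtractf flip: sum_distrib_left)
  also have "\<dots> = pi" using d by (simp add: d_def Int_def lessThan_def)
  finally have phase: "(\<Sum>j<length a. \<phi> (a ! j)) = pi" .
  \<comment> \<open>Frequency 0 accounts for the constant term \<open>1 / r\<close>.\<close>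
  define F where "F = insert 0 (set a \<union> uminus ` set a)"
  have neg: "- x \<in> F" if "x \<in> F" for x using that by (auto simp: F_def)
  have F: "finite F" "uminus ` (F - {0}) = F - {0}"
  proof -
    show "finite F" by (simp add: F_def)
    have "x \<in> uminus ` (F - {0})" if "x \<in> F - {0}" for x
      using that neg by (intro image_eqI[of _ _ "- x"]) auto
    then show "uminus ` (F - {0}) = F - {0}" using neg by auto
  qed
  define M where "M = Max (abs ` F)"
  have M: "\<bar>x\<bar> \<le> M" if "x \<in> F" for x unfolding M_def using F that by (intro Max_ge) auto
  have aF: "a ! j \<in> F" "- (a ! j) \<in> F" if "j < length a" for j using nth_mem[OF that]
    by (auto simp: F_def)
  have "a ! 0 \<in> F" "a ! 0 \<noteq> 0" using aF[of 0] nz[of 0] k by linarith+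
  with M have M0: "M > 0" by fastforce
  \<comment> \<open>The increments \<open>a ! j * \<gamma> i - a ! i * \<gamma> j\<close> are at
    most \<open>2 * M ^ 2\<close> in absolute value, so \<theta> times a nonzero one lies in
    \<open>[-1, 1]\<close> without 0, where \<open>cis\<close> is not 1.\<close>
  define \<theta> where "\<theta> = 1 / (2 * real_of_int M ^ 2)"
  define h where "h x = (\<Sum>f\<in>F - {0}. cos (real_of_int f * \<theta> * real x + \<phi> f))" for x
  \<comment> \<open>The imaginary parts cancel between \<open>f\<close> and \<open>- f\<close>, as
    \<open>F - {0}\<close> is symmetric and \<phi> is odd.\<close>
  have h_complex: "complex_of_real (h x)
      = (\<Sum>f\<in>F - {0}. cis (real_of_int f * \<theta> * real x + \<phi> f))" for x
  proof -
    have "(\<Sum>f\<in>F - {0}. sin (real_of_int f * \<theta> * real x + \<phi> f))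
        = (\<Sum>f\<in>uminus ` (F - {0}). sin (real_of_int f * \<theta> * real x + \<phi> f))"
      by (simp add: F)
    also have "\<dots> = (\<Sum>f\<in>F - {0}. sin (- (real_of_int f * \<theta> * real x + \<phi> f)))"
      by (subst sum.reindex) (auto simp: odd)
    also have "\<dots> = - (\<Sum>f\<in>F - {0}. sin (real_of_int f * \<theta> * real x + \<phi> f))"
      by (simp only: sin_minus sum_negf)
    finally show ?thesis by (simp add: complex_eq_iff h_def)
  qed
  have h_bound: "\<bar>h x\<bar> \<le> real (card F)" for x
  proof -
    have "\<bar>h x\<bar> \<le> (\<Sum>f\<in>F - {0}. 1)" unfolding h_def by (intro order.trans[OF sum_abs] sum_mono) auto
    also have "\<dots> \<le> real (card F)" using F(1) by (simp add: card_mono)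
    finally show ?thesis .
  qed
  \<comment> \<open>This is applied later with \<sigma> equal to \<epsilon>, -\<epsilon> and
    0.\<close>
  have main: "\<exists>C\<ge>0. \<forall>n. (\<Sum>x\<in>solutions a n. \<Prod>j<length a. 1 / real r + \<sigma> * h (x ! j))
      \<le> ((1 / real r) ^ length a - 2 * \<sigma> ^ length a) * real (card (solutions a n)) + C * real n ^ (length a - 2)" for \<sigma>
  proof -
    \<comment> \<open>The Fourier coefficients of \<open>1 / r + \<sigma> * h\<close>.\<close>
    define w :: "int \<Rightarrow> complex"
      where "w f = (if f = 0 then of_real (1 / real r) else of_real \<sigma> * cis (\<phi> f))" for f
    define \<Gamma> where "\<Gamma> = {..<length a} \<rightarrow>\<^sub>E F"
    define W where "W \<gamma> = (\<Prod>j<length a. w (\<gamma> j))" for \<gamma>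
    define T where "T n \<gamma> = (\<Sum>x\<in>solutions a n. cis (\<theta> * of_int (lincomb \<gamma> x)))" for n \<gamma>
    define \<gamma>0 where "\<gamma>0 = restrict (\<lambda>_. 0 :: int) {..<length a}"
    define \<gamma>1 where "\<gamma>1 = restrict (\<lambda>j. a ! j) {..<length a}"
    define \<gamma>2 where "\<gamma>2 = restrict (\<lambda>j. - (a ! j)) {..<length a}"
    have fin: "finite \<Gamma>" unfolding \<Gamma>_def using F by (intro finite_PiE) auto
    have good: "{\<gamma>0, \<gamma>1, \<gamma>2} \<subseteq> \<Gamma>" using aF by (auto simp: \<Gamma>_def \<gamma>0_def \<gamma>1_def \<gamma>2_def F_def)
    have k0: "0 < length a" using k by linarith
    have at0: "\<gamma>0 0 = 0" "\<gamma>1 0 = a ! 0" "\<gamma>2 0 = - (a ! 0)" using k0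
      by (auto simp: \<gamma>0_def \<gamma>1_def \<gamma>2_def)
    have dist: "\<gamma>0 \<noteq> \<gamma>1" "\<gamma>0 \<noteq> \<gamma>2" "\<gamma>1 \<noteq> \<gamma>2" using at0 nz[OF k0] by force+
    have fourier: "complex_of_real (1 / real r + \<sigma> * h v)
        = (\<Sum>f\<in>F. w f * cis (\<theta> * real_of_int f * real v))" for v
    proof -
      have "(\<Sum>f\<in>F. w f * cis (\<theta> * real_of_int f * real v)) = w 0
          + (\<Sum>f\<in>F - {0}. w f * cis (\<theta> * real_of_int f * real v))"
        using F(1) by (subst sum.remove[of _ 0]) (auto simp: F_def)
      also have "(\<Sum>f\<in>F - {0}. w f * cis (\<theta> * real_of_int f * real v))
          = (\<Sum>f\<in>F - {0}. of_real \<sigma> * cis (real_of_int f * \<theta> * real v + \<phi> f))"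
        by (intro sum.cong) (auto simp: w_def cis_mult algebra_simps)
      finally show ?thesis by (simp add: h_complex w_def sum_distrib_left)
    qed
    have expand: "complex_of_real (\<Prod>j<length a. 1 / real r + \<sigma> * h (x ! j))
        = (\<Sum>\<gamma>\<in>\<Gamma>. W \<gamma> * cis (\<theta> * of_int (lincomb \<gamma> x)))"
      if "x \<in> solutions a n" for x n
    proof -
      have "complex_of_real (\<Prod>j<length a. 1 / real r + \<sigma> * h (x ! j))
          = (\<Prod>j<length a. \<Sum>f\<in>F. w f * cis (\<theta> * real_of_int f * real (x ! j)))"
        by (simp only: of_real_prod fourier)
      also have "\<dots> = (\<Sum>\<gamma>\<in>\<Gamma>. \<Prod>j<length a. w (\<gamma> j) * cis (\<theta> * real_of_int (\<gamma> j) * real (x ! j)))"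
        unfolding \<Gamma>_def using F by (intro prod_sum_PiE) auto
      also have "\<dots> = (\<Sum>\<gamma>\<in>\<Gamma>. W \<gamma> * cis (\<theta> * of_int (lincomb \<gamma> x)))"
      proof (rule sum.cong[OF refl])
        fix \<gamma>
        have "\<theta> * of_int (lincomb \<gamma> x) = (\<Sum>j<length a. \<theta> * real_of_int (\<gamma> j) * real (x ! j))"
          by (simp add: lincomb_def length_solution[OF that] sum_distrib_left mult.assoc)
        then show "(\<Prod>j<length a. w (\<gamma> j) * cis (\<theta> * real_of_int (\<gamma> j) * real (x ! j)))
            = W \<gamma> * cis (\<theta> * of_int (lincomb \<gamma> x))"
          by (simp add: cis_sum prod.distrib W_def)
      qed
      finally show ?thesis .
    qed
    have total: "complex_of_real (\<Sum>x\<in>solutions a n. \<Prod>j<length a. 1 / real r + \<sigma> * h (x ! j))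
        = (\<Sum>\<gamma>\<in>\<Gamma>. W \<gamma> * T n \<gamma>)" for n
    proof -
      have "complex_of_real (\<Sum>x\<in>solutions a n. \<Prod>j<length a. 1 / real r + \<sigma> * h (x ! j))
          = (\<Sum>x\<in>solutions a n. \<Sum>\<gamma>\<in>\<Gamma>. W \<gamma> * cis (\<theta> * of_int (lincomb \<gamma> x)))"
        unfolding of_real_sum by (intro sum.cong refl expand)
      also have "\<dots> = (\<Sum>\<gamma>\<in>\<Gamma>. W \<gamma> * T n \<gamma>)"
        unfolding T_def sum_distrib_left by (rule sum.swap)
      finally show ?thesis .
    qed
    have "lincomb \<gamma>0 x = 0 \<and> lincomb \<gamma>1 x = 0 \<and> lincomb \<gamma>2 x = 0" if "x \<in> solutions a n" for x n
      using solution_sum[OF that] length_solution[OF that]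
      by (simp add: lincomb_def \<gamma>0_def \<gamma>1_def \<gamma>2_def sum_negf)
    then have T_good: "T n \<gamma>0 = of_nat (card (solutions a n))"
      "T n \<gamma>1 = of_nat (card (solutions a n))"
        "T n \<gamma>2 = of_nat (card (solutions a n))" for n
      by (simp_all add: T_def)
    \<comment> \<open>The phases add up to \<pi> for \<open>\<gamma>1\<close> and to -\<pi> for
      \<open>\<gamma>2\<close>, so both give the factor -1.\<close>
    have W_good: "W \<gamma>0 = of_real ((1 / real r) ^ length a)" "W \<gamma>1 = of_real (- (\<sigma> ^ length a))"
      "W \<gamma>2 = of_real (- (\<sigma> ^ length a))"
    proof -
      show "W \<gamma>0 = of_real ((1 / real r) ^ length a)" by (simp add: W_def \<gamma>0_def w_def)
      have "W \<gamma>1 = of_real \<sigma> ^ length a * cis (\<Sum>j<length a. \<phi> (a ! j))"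
        using nz by (simp add: W_def \<gamma>1_def w_def prod.distrib cis_sum)
      then show "W \<gamma>1 = of_real (- (\<sigma> ^ length a))" by (simp add: phase)
      have "W \<gamma>2 = of_real \<sigma> ^ length a * cis (\<Sum>j<length a. - \<phi> (a ! j))"
        using nz by (simp add: W_def \<gamma>2_def w_def prod.distrib cis_sum odd)
      also have "(\<Sum>j<length a. - \<phi> (a ! j)) = - pi" using phase by (simp add: sum_negf)
      finally show "W \<gamma>2 = of_real (- (\<sigma> ^ length a))" by (simp add: complex_eq_iff)
    qed
    have "\<forall>\<gamma>\<in>\<Gamma> - {\<gamma>0, \<gamma>1, \<gamma>2}. \<exists>C. \<forall>n. norm (T n \<gamma>) \<le> C * real n ^ (length a - 2)"
    proof
      fix \<gamma> assume \<gamma>: "\<gamma> \<in> \<Gamma> - {\<gamma>0, \<gamma>1, \<gamma>2}"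
      then have mem: "\<gamma> j \<in> F" if "j < length a" for j using that by (auto simp: \<Gamma>_def)
      have ext: "\<gamma> = restrict g {..<length a}" if "\<forall>j<length a. \<gamma> j = g j" for g
        using \<gamma> that by (auto simp: \<Gamma>_def PiE_def extensional_def restrict_def fun_eq_iff)
      have "\<not> ((\<forall>j<length a. \<gamma> j = 0) \<or> (\<forall>j<length a. \<gamma> j = a ! j) \<or> (\<forall>j<length a. \<gamma> j
          = - (a ! j)))"
        using \<gamma> ext[of "\<lambda>_. 0"] ext[of "\<lambda>j. a ! j"] ext[of "\<lambda>j. - (a ! j)"]
        unfolding \<gamma>0_def \<gamma>1_def \<gamma>2_def by blast
      then obtain i j where ij: "i < length a" "j < length a" "a ! j * \<gamma> i \<noteq> a ! i * \<gamma> j"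
        using proportional_coefficients_rigid[OF a0 k0, of \<gamma>] mem unfolding F_def by blast
      then have "i \<noteq> j" by auto
      define D where "D = a ! j * \<gamma> i - a ! i * \<gamma> j"
      have "\<bar>a ! j * \<gamma> i\<bar> \<le> M * M" "\<bar>a ! i * \<gamma> j\<bar> \<le> M * M"
        unfolding abs_mult using M aF mem ij M0 by (intro mult_mono; force)+
      then have "\<bar>D\<bar> \<le> 2 * M ^ 2" unfolding D_def power2_eq_square by linarith
      then have "real_of_int \<bar>D\<bar> \<le> real_of_int (2 * M ^ 2)" by (rule of_int_le_iff[THEN iffD2])
      then have "\<bar>\<theta> * real_of_int D\<bar> \<le> 1"
        using M0 by (simp add: \<theta>_def abs_mult divide_simps)
      moreover have "D \<noteq> 0" using ij(3) by (simp add: D_def)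
      then have "\<theta> * real_of_int D \<noteq> 0" using M0 by (simp add: \<theta>_def)
      ultimately have "cis (\<theta> * real_of_int D) \<noteq> 1" by (rule cis_neq_1)
      then show "\<exists>C. \<forall>n. norm (T n \<gamma>) \<le> C * real n ^ (length a - 2)"
        unfolding T_def D_def by (intro sum_character_solutions[OF a0 ij(1,2) \<open>i \<noteq> j\<close>])
    qed
    then obtain B
      where B: "\<And>\<gamma> n. \<gamma> \<in> \<Gamma> - {\<gamma>0, \<gamma>1, \<gamma>2} \<Longrightarrow> norm (T n \<gamma>) \<le> B \<gamma> * real n ^ (length a - 2)"
      by metis
    define C where "C = (\<Sum>\<gamma>\<in>\<Gamma> - {\<gamma>0, \<gamma>1, \<gamma>2}. norm (W \<gamma>) * \<bar>B \<gamma>\<bar>)"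
    have "(\<Sum>x\<in>solutions a n. \<Prod>j<length a. 1 / real r + \<sigma> * h (x ! j))
        \<le> ((1 / real r) ^ length a - 2 * \<sigma> ^ length a) * real (card (solutions a n)) + C * real n ^ (length a - 2)" for n
    proof -
      define Y where "Y = (\<Sum>x\<in>solutions a n. \<Prod>j<length a. 1 / real r + \<sigma> * h (x ! j))"
      define Z
        where "Z = ((1 / real r) ^ length a - 2 * \<sigma> ^ length a) * real (card (solutions a n))"
      have "(\<Sum>\<gamma>\<in>{\<gamma>0, \<gamma>1, \<gamma>2}. W \<gamma> * T n \<gamma>) = complex_of_real Z"
        using dist by (simp add: T_good W_good Z_def algebra_simps)
      then have "complex_of_real (Y - Z) = (\<Sum>\<gamma>\<in>\<Gamma> - {\<gamma>0, \<gamma>1, \<gamma>2}. W \<gamma> * T n \<gamma>)"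
        using total[of n] sum.subset_diff[OF good fin, of "\<lambda>\<gamma>. W \<gamma> * T n \<gamma>"] by (simp add: Y_def)
      then have "\<bar>Y - Z\<bar> = norm (\<Sum>\<gamma>\<in>\<Gamma> - {\<gamma>0, \<gamma>1, \<gamma>2}. W \<gamma> * T n \<gamma>)"
        by (metis norm_of_real)
      also have "\<dots> \<le> (\<Sum>\<gamma>\<in>\<Gamma> - {\<gamma>0, \<gamma>1, \<gamma>2}. norm (W \<gamma>) * (\<bar>B \<gamma>\<bar> * real n ^ (length a - 2)))"
      proof (rule sum_norm_le)
        fix \<gamma> assume \<gamma>: "\<gamma> \<in> \<Gamma> - {\<gamma>0, \<gamma>1, \<gamma>2}"
        have "B \<gamma> * real n ^ (length a - 2) \<le> \<bar>B \<gamma>\<bar> * real n ^ (length a - 2)"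
          by (intro mult_right_mono) auto
        then show "norm (W \<gamma> * T n \<gamma>) \<le> norm (W \<gamma>) * (\<bar>B \<gamma>\<bar> * real n ^ (length a - 2))"
          unfolding norm_mult using B[OF \<gamma>, of n] by (intro mult_left_mono) auto
      qed
      also have "\<dots> = C * real n ^ (length a - 2)" by (simp add: C_def sum_distrib_right mult.assoc)
      finally show ?thesis unfolding Y_def Z_def by linarith
    qed
    moreover have "C \<ge> 0" unfolding C_def by (intro sum_nonneg) auto
    ultimately show ?thesis by blast
  qed
  then obtain C where C: "\<And>\<sigma>. C \<sigma> \<ge> 0"
    "\<And>\<sigma> n. (\<Sum>x\<in>solutions a n. \<Prod>j<length a. 1 / real r + \<sigma> * h (x ! j))
      \<le> ((1 / real r) ^ length a - 2 * \<sigma> ^ length a) * real (card (solutions a n)) + C \<sigma> * real n ^ (length a - 2)"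
    by metis
  \<comment> \<open>Since \<open>\<bar>h x\<bar> \<le> card F\<close>, this choice keeps
    \<open>1 / r + \<epsilon> * h\<close> and \<open>1 / r - \<epsilon> * h\<close>
    nonnegative.\<close>
  define \<epsilon> where "\<epsilon> = 1 / (real r * real (card F))"
  have F0: "card F > 0" using F(1) by (auto simp: card_gt_0_iff F_def)
  have \<epsilon>: "\<epsilon> > 0" using F0 r by (simp add: \<epsilon>_def)
  define s where "s i = \<epsilon> * (of_bool (i = 1) - of_bool (i = 2))" for i :: nat
  have s_sum: "(\<Sum>i\<in>{1..r}. s i) = 0"
    using r by (simp add: s_def sum_subtractf flip: sum_distrib_left)
  \<comment> \<open>As the length is even, colors 1 and 2 both contribute
    \<open>\<epsilon> ^ length a\<close>. Two characters for each of them make the final gain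
    \<open>4 * \<epsilon> ^ length a\<close>.\<close>
  have s_pow: "(\<Sum>i\<in>{1..r}. s i ^ length a) = 2 * \<epsilon> ^ length a"
  proof -
    have "s i ^ length a = \<epsilon> ^ length a * (of_bool (i = 1) + of_bool (i = 2))" for i
      using even k by (auto simp: s_def power_mult_distrib)
    then show ?thesis using r by (simp add: sum.distrib flip: sum_distrib_left)
  qed
  have few: "(\<Sum>x\<in>solutions a n. \<Sum>i\<in>{1..r}. \<Prod>j<length a. 1 / real r + s i * h (x ! j))
      \<le> (real r powi (1 - int (length a)) - 4 * \<epsilon> ^ length a) * real (card (solutions a n))
        + (\<Sum>i\<in>{1..r}. C (s i)) * real n ^ (length a - 2)" for n
  proof -
    define N where "N = real (card (solutions a n))"
    have "(\<Sum>x\<in>solutions a n. \<Sum>i\<in>{1..r}. \<Prod>j<length a. 1 / real r + s i * h (x ! j))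
        = (\<Sum>i\<in>{1..r}. \<Sum>x\<in>solutions a n. \<Prod>j<length a. 1 / real r + s i * h (x ! j))"
      by (rule sum.swap)
    also have "\<dots>
        \<le> (\<Sum>i\<in>{1..r}. ((1 / real r) ^ length a - 2 * s i ^ length a) * N + C (s i) * real n ^ (length a - 2))"
      unfolding N_def by (intro sum_mono C)
    also have "\<dots> = (real r * (1 / real r) ^ length a - 2 * (\<Sum>i\<in>{1..r}. s i ^ length a)) * N
        + (\<Sum>i\<in>{1..r}. C (s i)) * real n ^ (length a - 2)"
      by (simp add: sum.distrib sum_subtractf flip: sum_distrib_right sum_distrib_left)
    also have "real r * (1 / real r) ^ length a = real r powi (1 - int (length a))"
      using r by (simp add: power_int_diff power_one_over)
    finally show ?thesis unfolding s_pow N_def by simp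
  qed
  show ?thesis
  proof (rule uncommonI[OF a0 k _ c(1) _ c(2)])
    show "0 < 4 * \<epsilon> ^ length a" using \<epsilon> by simp
    show "0 \<le> (\<Sum>i\<in>{1..r}. C (s i))" using C by (intro sum_nonneg) auto
    have "\<bar>s i * h v\<bar> \<le> \<epsilon> * real (card F)" for i v
      unfolding abs_mult using h_bound[of v] \<epsilon> by (intro mult_mono) (auto simp: s_def)
    then have "\<bar>s i * h v\<bar> \<le> 1 / real r" for i v using F0 by (simp add: \<epsilon>_def)
    then have "0 \<le> 1 / real r + s i * h v" for i v by (smt (verit))
    moreover have "(\<Sum>i\<in>{1..r}. 1 / real r + s i * h v) = 1" for v
      using s_sum r by (simp add: sum.distrib flip: sum_distrib_right)
    ultimately show "\<exists>\<^sub>F n in sequentially. \<exists>g. (\<forall>i\<in>{1..r}. \<forall>v\<in>{1..n}. 0 \<le> g i v)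
        \<and> (\<forall>v\<in>{1..n}. (\<Sum>i\<in>{1..r}. g i v) = 1)
        \<and> (\<Sum>x\<in>solutions a n. \<Sum>i\<in>{1..r}. \<Prod>j<length a. g i (x ! j))
            \<le> (real r powi (1 - int (length a)) - 4 * \<epsilon> ^ length a) * real (card (solutions a n))
              + (\<Sum>i\<in>{1..r}. C (s i)) * real n ^ (length a - 2)"
      using few
        by (intro eventually_frequently always_eventually allI exI[of _ "\<lambda>i v. 1 / real r
            + s i * h v"]) auto
  qed
qed

section \<open>The equation \<open>x + 2y = z + 2w\<close>\<close>

text \<open>Entries start at 0, so that division by \<open>L\<close> yields the block. The shift
  does not affect the equation because its coefficients sum to 0.\<close>

definition box :: "nat \<Rightarrow> (nat \<times> nat \<times> nat \<times> nat) set" where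
  "box n = {..<n} \<times> {..<n} \<times> {..<n} \<times> {..<n}"

fun form :: "nat \<times> nat \<times> nat \<times> nat \<Rightarrow> int" where
  "form (x, y, z, w) = int x + 2 * int y - int z - 2 * int w"

fun prod4 :: "(nat \<Rightarrow> 'a::comm_monoid_mult) \<Rightarrow> nat \<times> nat \<times> nat \<times> nat \<Rightarrow> 'a" where
  "prod4 F (x, y, z, w) = F x * F y * F z * F w"

text \<open>Nonzero \<open>t\<close> is needed because offsets inside the blocks must compensate for
  block indices that do not solve the equation themselves.\<close>

definition sol_count :: "nat \<Rightarrow> int \<Rightarrow> real" where
  "sol_count L t = (\<Sum>p\<in>box L. of_bool (form p = t))"

definition sol_weight :: "(nat \<Rightarrow> real) \<Rightarrow> nat \<Rightarrow> real" where
  "sol_weight F n = (\<Sum>p\<in>box n. of_bool (form p = 0) * prod4 F p)"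

lemma finite_box [simp]: "finite (box n)"
  by (simp add: box_def)

lemma sum_box: "sum f (box n) = (\<Sum>a<n. \<Sum>b<n. \<Sum>c<n. \<Sum>d<n. f (a, b, c, d))"
  by (simp add: box_def sum.cartesian_product split_def)

fun scale_add :: "nat \<Rightarrow> nat \<times> nat \<times> nat \<times> nat \<Rightarrow> nat \<times> nat \<times> nat \<times> nat \<Rightarrow> nat \<times> nat \<times> nat \<times> nat" where
  "scale_add L (a, b, c, d) (x, y, z, w) = (a * L + x, b * L + y, c * L + z, d * L + w)"

lemma block_index_less: "a < N \<Longrightarrow> x < L \<Longrightarrow> a * L + x < N * (L :: nat)"
proof -
  assume "a < N" "x < L"
  then have "a * L + x < Suc a * L" by simp
  also have "\<dots> \<le> N * L" using \<open>a < N\<close> by (intro mult_right_mono) auto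
  finally show ?thesis .
qed

text \<open>Division with remainder by \<open>L\<close> in every coordinate.\<close>

lemma sum_box_blocks:
  assumes L: "L > 0"
  shows "(\<Sum>p\<in>box (N * L). f p) = (\<Sum>q\<in>box N. \<Sum>p\<in>box L. f (scale_add L q p))"
proof -
  have "(\<Sum>p\<in>box (N * L). f p) = (\<Sum>(q, p)\<in>box N \<times> box L. f (scale_add L q p))"
    by (rule sum.reindex_bij_witness[of _ "\<lambda>(q, p). scale_add L q p"
          "\<lambda>(x, y, z, w). ((x div L, y div L, z div L, w div L), (x mod L, y mod L, z mod L, w mod L))"])
       (use L in \<open>auto simp: box_def less_mult_imp_div_less block_index_less\<close>)
  then show ?thesis by (simp add: sum.cartesian_product)
qed

lemma form_scale_add: "form (scale_add L q p) = int L * form q + form p"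
  by (cases q; cases p) (simp add: algebra_simps)

lemma sol_count_blocks:
  assumes "L > 0"
  shows "sol_count (N * L) t = (\<Sum>q\<in>box N. sol_count L (t - int L * form q))"
  unfolding sol_count_def sum_box_blocks[OF assms] form_scale_add
    by (simp add: eq_diff_eq add.commute)

lemma sol_count_uminus: "sol_count L (- t) = sol_count L t"
  unfolding sol_count_def
  by (rule sum.reindex_bij_witness[of _ "\<lambda>(x, y, z, w). (z, w, x, y)"
    "\<lambda>(x, y, z, w). (z, w, x, y)"])
     (auto simp: box_def)

text \<open>A nonempty box has \<open>\<bar>form p\<bar> \<le> 3 * (L - 1)\<close>. Among the
  multiples of \<open>L\<close>, only 0 and plus or minus \<open>L\<close> and \<open>2 * L\<close>
  can therefore have solutions.\<close>

lemma sol_count_eq_0: "3 * int L \<le> \<bar>t\<bar> \<Longrightarrow> sol_count L t = 0"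
  unfolding sol_count_def by (rule sum.neutral) (auto simp: box_def)

lemma sol_count_double:
  assumes "L > 0"
  shows "sol_count (2 * L) (int (2 * L) * s) = (\<Sum>q\<in>box 2. sol_count L (int L * (2 * s - form q)))"
  using sol_count_blocks[OF assms, of 2] by (simp add: algebra_simps)

text \<open>
  Halving the box expresses the counts for \<open>2 * L\<close> through those for \<open>L\<close>, which determines them
  exactly when \<open>L\<close> is a power of two; \<open>10, 6, 1\<close> is the eigenvector for the eigenvalue \<open>2 ^ 3\<close>.
\<close>

lemma sol_count_power_2:
  defines "L \<equiv> \<lambda>j. (2 :: nat) ^ Suc j"
  shows "24 * sol_count (L j) 0 = 10 * real (L j) ^ 3 + 8 * real (L j)
       \<and> 24 * sol_count (L j) (int (L j)) = 6 * real (L j) ^ 3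
       \<and> 24 * sol_count (L j) (2 * int (L j)) = real (L j) ^ 3 - 4 * real (L j)"
proof (induction j)
  case 0
  show ?case
    by (simp add: L_def sol_count_def sum_box numeral_2_eq_2 lessThan_Suc)
next
  case (Suc j)
  define v where "v s = sol_count (L j) (int (L j) * s)" for s
  have pos: "L j > 0" by (simp add: L_def)
  have LS: "L (Suc j) = 2 * L j" by (simp add: L_def)
  have v: "v (- s) = v s" for s
    using sol_count_uminus[of "L j" "int (L j) * s"] by (simp add: v_def)
  have v3: "v s = 0" if "s \<ge> 3" for s
    unfolding v_def using mult_left_mono[OF that, of "int (L j)"] that
    by (intro sol_count_eq_0) (simp add: abs_mult mult.commute)
  have box2: "sum f (box 2)
      = (\<Sum>x\<in>{0,1}. \<Sum>y\<in>{0,1}. \<Sum>z\<in>{0,1}. \<Sum>w\<in>{0,1}. f (x, y, z, w))" for f :: "_ \<Rightarrow> real"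
    by (simp add: sum_box numeral_2_eq_2 lessThan_Suc add_ac)
  \<comment> \<open>On \<open>box 2\<close> the form takes the values 0, 1, 2, 3 with multiplicities
    4, 3, 2, 1, and likewise for negative values. This gives the coefficients below.\<close>
  have step: "sol_count (L (Suc j)) (int (L (Suc j)) * s) = (\<Sum>q\<in>box 2. v (2 * s - form q))" for s
    using sol_count_double[OF pos] unfolding LS v_def by simp
  have "sol_count (L (Suc j)) 0 = 4 * v 0 + 6 * v 1 + 4 * v 2"
    using step[of 0] v[of 1] v[of 2] v3[of 3] v[of 3] by (simp add: box2)
  moreover have "sol_count (L (Suc j)) (int (L (Suc j))) = 2 * v 0 + 4 * v 1 + 4 * v 2"
    using step[of 1] v[of 1] v3[of 3] v3[of 4] v3[of 5] by (simp add: box2)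
  moreover have "sol_count (L (Suc j)) (2 * int (L (Suc j))) = v 1 + 2 * v 2"
    using step[of 2] v3[of 3] v3[of 4] v3[of 5] v3[of 6] v3[of 7] by (simp add: box2 mult.commute)
  \<comment> \<open>The linear parts \<open>8, 0, -4\<close> form an eigenvector of the same
    recursion for the eigenvalue 2.\<close>
  ultimately show ?case
    using Suc unfolding LS v_def by (simp add: mult.commute power3_eq_cube)
qed

text \<open>
  \<open>pair_sum N F m\<close> is the coefficient of \<open>X\<^bsup>m\<^esup>\<close> in \<open>P(X) P(X\<^sup>2)\<close>, where \<open>P = \<Sum>b<N. F b X\<^bsup>b\<^esup>\<close>. It is
  defined by a single sum so that it can be evaluated.
\<close>

definition pair_sum :: "nat \<Rightarrow> (nat \<Rightarrow> 'a::comm_semiring_1) \<Rightarrow> nat \<Rightarrow> 'a" where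
  "pair_sum N F m = (\<Sum>b\<in>{..<N}. if 2 * b \<le> m \<and> m < 2 * b + N then F (m - 2 * b) * F b else 0)"

text \<open>The autocorrelation at lag \<open>e\<close> of the coefficients of
  \<open>P(X) P(X^2)\<close>. A double sum replaces the fourfold sum over blocks, which keeps
  evaluation cheap.\<close>

definition correlation :: "nat \<Rightarrow> (nat \<Rightarrow> 'a::comm_semiring_1) \<Rightarrow> nat \<Rightarrow> 'a" where
  "correlation N F e = (\<Sum>m\<in>{..<3 * N}. pair_sum N F (m + e) * pair_sum N F m)"

lemma pair_sum_eq:
  "pair_sum N F m = (\<Sum>a<N. \<Sum>b<N. of_bool (a + 2 * b = m) * (F a * F b))"
proof -
  have "(\<Sum>a<N. of_bool (a + 2 * b = m) * (F a * F b))
      = (if 2 * b \<le> m \<and> m < 2 * b + N then F (m - 2 * b) * F b else 0)" for b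
  proof (cases "2 * b \<le> m \<and> m < 2 * b + N")
    case True
    then have "(\<Sum>a<N. of_bool (a + 2 * b = m) * (F a * F b))
        = (\<Sum>a<N. if a = m - 2 * b then F a * F b else 0)"
      by (intro sum.cong) auto
    also have "\<dots> = F (m - 2 * b) * F b" using True by (subst sum.delta) auto
    finally show ?thesis using True by simp
  next
    case False
    then have "(\<Sum>a<N. of_bool (a + 2 * b = m) * (F a * F b)) = 0" by (intro sum.neutral) auto
    then show ?thesis using False by (simp only: if_False)
  qed
  then show ?thesis unfolding pair_sum_def by (subst sum.swap) simp
qed

text \<open>Grouping the quadruples by \<open>m = a + 2 * b\<close>, which is below
  \<open>3 * N\<close>, leaves the condition \<open>c + 2 * d = m + e\<close>; hence the minus
  sign.\<close>

lemma correlation_uminus_eq: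
  "correlation N F e = (\<Sum>q\<in>box N. of_bool (form q = - int e) * prod4 F q)"
proof -
  have "correlation N F e
      = (\<Sum>m<3 * N. \<Sum>a<N. \<Sum>b<N. of_bool (a + 2 * b = m) * (pair_sum N F (m + e) * (F a * F b)))"
    unfolding correlation_def
    by (subst (2) pair_sum_eq) (simp add: sum_distrib_left mult_ac)
  also have "\<dots>
      = (\<Sum>a<N. \<Sum>b<N. \<Sum>m<3 * N. of_bool (a + 2 * b = m) * (pair_sum N F (m + e) * (F a * F b)))"
    by (subst sum.swap, rule sum.cong[OF refl], subst sum.swap) (rule refl)
  also have "\<dots> = (\<Sum>a<N. \<Sum>b<N. pair_sum N F (a + 2 * b + e) * (F a * F b))"
  proof (intro sum.cong refl)
    fix a b assume "a \<in> {..<N}" "b \<in> {..<N}"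
    then have "a + 2 * b \<in> {..<3 * N}" by auto
    moreover have "of_bool (a + 2 * b = m) * (pair_sum N F (m + e) * (F a * F b))
        = (if m = a + 2 * b then pair_sum N F (m + e) * (F a * F b) else 0)" for m
      by auto
    ultimately show "(\<Sum>m<3 * N. of_bool (a + 2 * b = m) * (pair_sum N F (m + e) * (F a * F b)))
        = pair_sum N F (a + 2 * b + e) * (F a * F b)"
      by (simp only: sum.delta finite_lessThan if_True)
  qed
  also have "\<dots>
      = (\<Sum>a<N. \<Sum>b<N. \<Sum>c<N. \<Sum>d<N. of_bool (form (a, b, c, d) = - int e) * prod4 F (a, b, c, d))"
    unfolding pair_sum_eq sum_distrib_right
  proof (intro sum.cong refl)
    fix a b c d
    have "c + 2 * d = a + 2 * b + e \<longleftrightarrow> form (a, b, c, d) = - int e" by auto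
    then show "of_bool (c + 2 * d = a + 2 * b + e) * (F c * F d) * (F a * F b)
        = of_bool (form (a, b, c, d) = - int e) * prod4 F (a, b, c, d)"
      by (simp only: prod4.simps mult_ac)
  qed
  also have "\<dots> = (\<Sum>q\<in>box N. of_bool (form q = - int e) * prod4 F q)"
    by (simp only: sum_box)
  finally show ?thesis .
qed

lemma correlation_eq:
  "correlation N F e = (\<Sum>q\<in>box N. of_bool (form q = int e) * prod4 F q)"
  unfolding correlation_uminus_eq
  by (rule sum.reindex_bij_witness[of _ "\<lambda>(x, y, z, w). (z, w, x, y)"
    "\<lambda>(x, y, z, w). (z, w, x, y)"])
     (auto simp: box_def mult_ac)

section \<open>Weights of step functions\<close>

text \<open>The product is constant on each quadruple \<open>q\<close> of blocks, and the offsets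
  contribute \<open>sol_count L (L * form q)\<close>. Only \<open>\<bar>form q\<bar> \<le> 2\<close>
  matters, and symmetry under sign change gives the factors 2.\<close>

lemma sol_weight_step_function:
  assumes L: "L > 0"
  shows "sol_weight (\<lambda>v. F (v div L)) (N * L)
    = sol_count L 0 * correlation N F 0 + 2 * sol_count L (int L) * correlation N F 1
      + 2 * sol_count L (2 * int L) * correlation N F 2"
proof -
  have P: "prod4 (\<lambda>v. F (v div L)) (scale_add L q p) = prod4 F q" if "p \<in> box L" for p q
    using that L by (cases q; cases p) (auto simp: box_def)
  have "sol_weight (\<lambda>v. F (v div L)) (N * L)
      = (\<Sum>q\<in>box N. \<Sum>p\<in>box L. of_bool (form p = - int L * form q) * prod4 F q)"
    unfolding sol_weight_def sum_box_blocks[OF L] form_scale_add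
    by (intro sum.cong refl) (auto simp: P)
  also have "\<dots> = (\<Sum>q\<in>box N. sol_count L (int L * form q) * prod4 F q)"
    using sol_count_uminus[of L] by (simp add: sol_count_def sum_distrib_right[symmetric])
  also have "\<dots> = (\<Sum>q\<in>box N. sol_count L 0 * (of_bool (form q = int 0) * prod4 F q)
      + sol_count L (int L) * (of_bool (form q = int 1) * prod4 F q + of_bool (form q = - int 1) * prod4 F q)
      + sol_count L (2 * int L) * (of_bool (form q = int 2) * prod4 F q + of_bool (form q = - int 2) * prod4 F q))"
  proof (rule sum.cong[OF refl])
    fix q
    consider "form q = 0" | "form q = 1" | "form q = - 1" | "form q = 2" | "form q = - 2" | "3
        \<le> \<bar>form q\<bar>"
      by linarith
    then show "sol_count L (int L * form q) * prod4 F q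
        = sol_count L 0 * (of_bool (form q = int 0) * prod4 F q)
      + sol_count L (int L) * (of_bool (form q = int 1) * prod4 F q + of_bool (form q = - int 1) * prod4 F q)
      + sol_count L (2 * int L) * (of_bool (form q = int 2) * prod4 F q + of_bool (form q = - int 2) * prod4 F q)"
    proof cases
      case 6
      then have "int L * 3 \<le> int L * \<bar>form q\<bar>" by (intro mult_left_mono) auto
      then have "sol_count L (int L * form q) = 0"
        by (intro sol_count_eq_0) (simp add: abs_mult mult.commute)
      with 6 show ?thesis by auto
    qed (simp_all add: sol_count_uminus mult.commute)
  qed
  also have "\<dots> = sol_count L 0 * correlation N F 0
      + sol_count L (int L) * (correlation N F 1 + correlation N F 1)
      + sol_count L (2 * int L) * (correlation N F 2 + correlation N F 2)"
    by (simp only: sum.distrib sum_distrib_left[symmetric] flip: correlation_eq correlation_uminus_eq)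
  finally show ?thesis by simp
qed

text \<open>
  Rounded from a numerical eigenvector with negative eigenvalue of the second-order term of
  \<open>\<epsilon> \<mapsto> sol_weight (1 + \<epsilon> z)\<close>, where \<open>z\<close> is a step function with 12 blocks.
\<close>

definition bump :: "int list" where
  "bump = [-1, 5, -5, -5, 6, 0, 0, 6, -5, -5, 5, -1]"

text \<open>Adding both signs cancels the odd orders in \<open>bump\<close> and leaves the second
  and fourth. The scale 60 makes all values integers, which can be computed exactly.\<close>

lemma bump_correlations:
  "correlation 12 (\<lambda>b. 60 + bump ! b) 0
      + correlation 12 (\<lambda>b. 60 - bump ! b) 0 - 2 * correlation 12 (\<lambda>b. 60) 0 = 72712"
  "correlation 12 (\<lambda>b. 60 + bump ! b) 1
      + correlation 12 (\<lambda>b. 60 - bump ! b) 1 - 2 * correlation 12 (\<lambda>b. 60) 1 = - 370276"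
  "correlation 12 (\<lambda>b. 60 + bump ! b) 2
      + correlation 12 (\<lambda>b. 60 - bump ! b) 2 - 2 * correlation 12 (\<lambda>b. 60) 2 = 1507176"
  by code_simp+

section \<open>Transfer to the equation and conclusion\<close>

lemma card_solutions_le:
  assumes a0: "0 \<notin> set a" and k: "length a > 0"
  shows "card (solutions a n) \<le> n ^ (length a - 1)"
proof -
  have "card (solutions a n) \<le> n ^ card {..<length a - 1}"
    by (rule card_le_if_inj_on_restrict[of _ a]) (use k in \<open>auto intro!: solution_eqI[OF _ _ a0, of _ n _ "length a - 1"]\<close>)
  then show ?thesis by simp
qed

text \<open>Lowering every entry by 1 preserves the equation, since 1 + 2 - 1 - 2 = 0.\<close>

lemma sum_solutions_eq_sol_weight:
  "(\<Sum>x\<in>solutions [1, 2, -1, -2] n. \<Prod>j<length [1, 2, -1, -2 :: int]. f (x ! j))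
      = sol_weight (\<lambda>v. f (Suc v)) n"
proof -
  have "(\<Sum>x\<in>solutions [1, 2, -1, -2] n. \<Prod>j<length [1, 2, -1, -2 :: int]. f (x ! j))
      = (\<Sum>p\<in>{p \<in> box n. form p = 0}. prod4 (\<lambda>v. f (Suc v)) p)"
  proof (rule sum.reindex_bij_witness[of _ "\<lambda>(x, y, z, w). [Suc x, Suc y, Suc z, Suc w]"
        "\<lambda>x. (x ! 0 - 1, x ! 1 - 1, x ! 2 - 1, x ! 3 - 1)"])
    fix x assume x: "x \<in> solutions [1, 2, -1, -2] n"
    then obtain p q s t where xs: "x = [p, q, s, t]"
      by (auto simp: solutions_def length_Suc_conv)
    have range: "p \<in> {1..n}" "q \<in> {1..n}" "s \<in> {1..n}" "t \<in> {1..n}"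
      using x by (auto simp: solutions_def xs)
    have "int p + 2 * int q - int s - 2 * int t = 0"
      using x by (simp add: solutions_def xs numeral_nat)
    with range show "(x ! 0 - 1, x ! 1 - 1, x ! 2 - 1, x ! 3 - 1) \<in> {p \<in> box n. form p = 0}"
      by (auto simp: xs box_def of_nat_diff)
    show "(case (x ! 0 - 1, x ! 1 - 1, x ! 2 - 1, x ! 3 - 1) of (x, y, z, w) \<Rightarrow> [Suc x, Suc y, Suc z, Suc w]) = x"
      using range by (simp add: xs)
    show "prod4 (\<lambda>v. f (Suc v)) (x ! 0 - 1, x ! 1 - 1, x ! 2 - 1, x ! 3 - 1)
        = (\<Prod>j<length [1, 2, -1, -2 :: int]. f (x ! j))"
      using range by (simp add: xs numeral_nat)
  next
    fix p assume "p \<in> {p \<in> box n. form p = 0}"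
    then show "(case p of (x, y, z, w) \<Rightarrow> [Suc x, Suc y, Suc z, Suc w]) \<in> solutions [1, 2, -1, -2] n"
      by (cases p) (auto simp: solutions_def box_def numeral_nat)
  qed auto
  also have "\<dots> = sol_weight (\<lambda>v. f (Suc v)) n"
    by (simp add: sol_weight_def Int_def)
  finally show ?thesis .
qed

lemma sol_weight_mult: "sol_weight (\<lambda>v. c * F v) n = c ^ 4 * sol_weight F n"
proof -
  have "prod4 (\<lambda>v. c * F v) p = c ^ 4 * prod4 F p" for p
    by (cases p) (simp add: power4_eq_xxxx)
  then show ?thesis
    by (simp add: sol_weight_def sum_distrib_left mult_ac del: sum_of_bool_mult_eq sum_mult_of_bool_eq)
qed

lemma correlation_of_int: "correlation N (\<lambda>b. real_of_int (f b)) e = of_int (correlation N f e)"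
  by (simp add: correlation_def pair_sum_def if_distrib cong: if_cong)

text \<open>The cubic parts 10, 6, 1 of the counts, divided by 24, give
  \<open>(72712 * 10 - 740552 * 6 + 3014352) / 24\<close>, which is about -29243.3. The part linear
  in \<open>L\<close> is negative too.\<close>

lemma bump_sol_weight:
  fixes j :: nat
  defines "L \<equiv> (2 :: nat) ^ Suc j"
  defines "W \<equiv> \<lambda>\<sigma>. sol_weight (\<lambda>v. 60 + \<sigma> * of_int (bump ! (v div L))) (12 * L)"
  shows "W 1 + W (- 1) - 2 * W 0 \<le> - 29243 * real L ^ 3"
proof -
  have L: "L > 0" by (simp add: L_def)
  note cnt = sol_count_power_2[of j, folded L_def]
  define R where "R \<sigma> e = real_of_int (correlation 12 (\<lambda>b. 60 + \<sigma> * bump ! b) e)" for \<sigma> e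
  have W: "W (of_int \<sigma>) = sol_count L 0 * R \<sigma> 0 + 2 * sol_count L (int L) * R \<sigma> 1
      + 2 * sol_count L (2 * int L) * R \<sigma> 2" for \<sigma>
  proof -
    have "correlation 12 (\<lambda>b. 60 + real_of_int \<sigma> * real_of_int (bump ! b)) e = R \<sigma> e" for e
      using correlation_of_int[of 12 "\<lambda>b. 60 + \<sigma> * bump ! b" e] by (simp add: R_def)
    then show ?thesis unfolding W_def by (subst sol_weight_step_function[OF L, where N = 12]) simp
  qed
  have "R 1 e + R (- 1) e - 2 * R 0 e = of_int (correlation 12 (\<lambda>b. 60 + bump ! b) e
      + correlation 12 (\<lambda>b. 60 - bump ! b) e - 2 * correlation 12 (\<lambda>b. 60) e)" for e
    by (simp add: R_def)
  then have R: "R 1 0 + R (- 1) 0 - 2 * R 0 0 = 72712" "R 1 1 + R (- 1) 1 - 2 * R 0 1 = - 370276"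
      "R 1 2 + R (- 1) 2 - 2 * R 0 2 = 1507176"
    by (simp_all only: bump_correlations of_int_numeral of_int_neg_numeral)
  have "W 1 + W (- 1) - 2 * W 0 = sol_count L 0 * (R 1 0 + R (- 1) 0 - 2 * R 0 0)
      + 2 * sol_count L (int L) * (R 1 1 + R (- 1) 1 - 2 * R 0 1)
      + 2 * sol_count L (2 * int L) * (R 1 2 + R (- 1) 2 - 2 * R 0 2)"
    using W[of 1] W[of "- 1"] W[of 0] by (simp add: algebra_simps)
  also have "\<dots> = 72712 * sol_count L 0 - 740552 * sol_count L (int L)
      + 3014352 * sol_count L (2 * int L)"
    unfolding R by simp
  also have "\<dots> \<le> - 29243 * real L ^ 3"
  proof -
    have "0 \<le> real L" "0 \<le> real L ^ 3" by simp_all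
    then show ?thesis
      using cnt[THEN conjunct1] cnt[THEN conjunct2, THEN conjunct1] cnt[THEN conjunct2, THEN conjunct2]
      by linarith
  qed
  finally show ?thesis .
qed

lemma uncommon_1_2:
  assumes r: "r \<ge> 2"
  shows "uncommon r [1, 2, -1, -2]"
proof -
  define a where "a = [1, 2, -1, -2 :: int]"
  have a: "length a = 4" "0 \<notin> set a" "a ! 0 > 0" "a ! 2 < 0" by (simp_all add: a_def)
  obtain c where c: "c > 0"
    "\<forall>\<^sub>F n in sequentially. c * real n ^ (length a - 1) \<le> real (card (solutions a n))"
    by (rule card_solutions_ge[of 0 a 2]) (use a in auto)
  \<comment> \<open>Chosen so that \<open>\<kappa> * 60 = 1 / r\<close>.\<close>
  define \<kappa> where "\<kappa> = 1 / (60 * real r)"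
  define s :: "nat \<Rightarrow> real" where "s i = of_bool (i = 1) - of_bool (i = 2)" for i
  \<comment> \<open>Points start at 1, so the block of \<open>v\<close> is
    \<open>(v - 1) div L\<close>.\<close>
  define g where "g L i v = \<kappa> * (60 + s i * of_int (bump ! ((v - 1) div L)))" for L i v :: nat
  have few: "(\<Sum>x\<in>solutions a (12 * L). \<Sum>i\<in>{1..r}. \<Prod>j<length a. g L i (x ! j))
      \<le> (real r powi (1 - int (length a)) - 16 * \<kappa> ^ 4) * real (card (solutions a (12 * L)))"
    if L_def: "L = 2 ^ Suc j" for L j :: nat
  proof -
    define W where "W \<sigma> = sol_weight (\<lambda>v. 60 + \<sigma> * of_int (bump ! (v div L))) (12 * L)" for \<sigma>
    define N where "N = real (card (solutions a (12 * L)))"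
    have "W 0 = sol_weight (\<lambda>v. 60 * 1) (12 * L)" by (simp add: W_def)
    also have "\<dots> = 60 ^ 4 * sol_weight (\<lambda>v. 1) (12 * L)" by (rule sol_weight_mult)
    also have "sol_weight (\<lambda>v. 1) (12 * L) = N"
      using sum_solutions_eq_sol_weight[of "\<lambda>_. 1" "12 * L"] by (simp add: N_def a_def)
    finally have W0: "W 0 = 60 ^ 4 * N" .
    have "W (s i) = W 0 + of_bool (i = 1) * (W 1 - W 0) + of_bool (i = 2) * (W (- 1) - W 0)" for i
      by (simp add: s_def)
    then have sumW: "(\<Sum>i\<in>{1..r}. W (s i)) = real r * W 0 + (W 1 + W (- 1) - 2 * W 0)"
      using r by (simp add: sum.distrib flip: sum_distrib_right)
    have "N \<le> real ((12 * L) ^ (length a - 1))"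
      unfolding N_def using card_solutions_le[of a "12 * L"] a by (intro of_nat_mono) auto
    then have "N \<le> 1728 * real L ^ 3" using a by (simp add: power_mult_distrib)
    moreover have "0 \<le> real L ^ 3" by simp
    \<comment> \<open>There are at most \<open>(12 * L) ^ 3 = 1728 * L ^ 3\<close> solutions, and
      \<open>16 * 1728 = 27648 \<le> 29243\<close>.\<close>
    ultimately have gain: "W 1 + W (- 1) - 2 * W 0 \<le> - 16 * N"
      using bump_sol_weight[of j, folded L_def] unfolding W_def by linarith
    have "(\<Sum>x\<in>solutions a (12 * L). \<Sum>i\<in>{1..r}. \<Prod>j<length a. g L i (x ! j))
        = (\<Sum>i\<in>{1..r}. \<kappa> ^ 4 * W (s i))"
    proof (subst sum.swap, rule sum.cong[OF refl])
      fix i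
      show "(\<Sum>x\<in>solutions a (12 * L). \<Prod>j<length a. g L i (x ! j)) = \<kappa> ^ 4 * W (s i)"
        unfolding a_def sum_solutions_eq_sol_weight W_def by (simp add: g_def sol_weight_mult)
    qed
    also have "\<dots> = \<kappa> ^ 4 * (real r * (60 ^ 4 * N)) + \<kappa> ^ 4 * (W 1 + W (- 1) - 2 * W 0)"
      unfolding sum_distrib_left[symmetric] sumW unfolding W0 by (simp add: distrib_left)
    also have "\<dots> \<le> \<kappa> ^ 4 * (real r * (60 ^ 4 * N)) + \<kappa> ^ 4 * (- 16 * N)"
      using gain by (intro add_left_mono mult_left_mono) auto
    also have "\<kappa> ^ 4 * (real r * (60 ^ 4 * N)) = real r powi (1 - int (length a)) * N"
    proof -
      have "real r powi (1 - int (length a)) = real r / real r ^ 4"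
        using r a(1) by (subst power_int_diff) simp_all
      then show ?thesis by (simp add: \<kappa>_def power_divide power_mult_distrib)
    qed
    finally show ?thesis by (simp add: N_def algebra_simps)
  qed
  have "uncommon r a"
  proof (rule uncommonI[OF a(2) _ _ c(1) _ c(2), of "16 * \<kappa> ^ 4" 0])
    show "\<exists>\<^sub>F n in sequentially. \<exists>g. (\<forall>i\<in>{1..r}. \<forall>v\<in>{1..n}. 0 \<le> g i v)
        \<and> (\<forall>v\<in>{1..n}. (\<Sum>i\<in>{1..r}. g i v) = 1)
        \<and> (\<Sum>x\<in>solutions a n. \<Sum>i\<in>{1..r}. \<Prod>j<length a. g i (x ! j))
            \<le> (real r powi (1 - int (length a)) - 16 * \<kappa> ^ 4) * real (card (solutions a n))
              + 0 * real n ^ (length a - 2)"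
      unfolding frequently_sequentially
    proof
      fix m :: nat
      \<comment> \<open>The lengths \<open>12 * 2 ^ Suc m\<close> exceed every bound
        \<open>m\<close>, so suitable \<open>n\<close> occur infinitely often.\<close>
      define L where "L = (2 :: nat) ^ Suc m"
      have "m < L" unfolding L_def by (metis less_exp less_trans lessI)
      have bump: "\<bar>real_of_int (bump ! b)\<bar> \<le> 60" if "b < 12" for b
      proof -
        have "bump ! b \<in> set bump" using that by (intro nth_mem) (simp add: bump_def)
        moreover have "\<forall>x\<in>set bump. \<bar>x\<bar> \<le> 60" by (simp add: bump_def)
        ultimately have "\<bar>bump ! b\<bar> \<le> 60" by blast
        then show ?thesis by linarith
      qed
      have "0 \<le> g L i v" if v: "v \<in> {1..12 * L}" for i v
      proof -
        have "(v - 1) div L < 12" using v by (intro less_mult_imp_div_less) auto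
        then have "\<bar>s i * real_of_int (bump ! ((v - 1) div L))\<bar> \<le> 1 * 60"
          unfolding abs_mult by (intro mult_mono bump) (auto simp: s_def)
        then have "0 \<le> 60 + s i * real_of_int (bump ! ((v - 1) div L))" by linarith
        then show ?thesis unfolding g_def \<kappa>_def by (intro mult_nonneg_nonneg) auto
      qed
      moreover have "(\<Sum>i\<in>{1..r}. g L i v) = 1" for v
      proof -
        have s0: "(\<Sum>i\<in>{1..r}. s i) = 0" using r by (simp add: s_def sum_subtractf)
        have "(\<Sum>i\<in>{1..r}. g L i v)
            = \<kappa> * (60 * real r + (\<Sum>i\<in>{1..r}. s i) * of_int (bump ! ((v - 1) div L)))"
          by (simp add: g_def sum.distrib flip: sum_distrib_left sum_distrib_right)
        then show ?thesis unfolding s0 using r by (simp add: \<kappa>_def)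
      qed
      ultimately show "\<exists>n\<ge>m. \<exists>g. (\<forall>i\<in>{1..r}. \<forall>v\<in>{1..n}. 0 \<le> g i v)
        \<and> (\<forall>v\<in>{1..n}. (\<Sum>i\<in>{1..r}. g i v) = 1)
        \<and> (\<Sum>x\<in>solutions a n. \<Sum>i\<in>{1..r}. \<Prod>j<length a. g i (x ! j))
            \<le> (real r powi (1 - int (length a)) - 16 * \<kappa> ^ 4) * real (card (solutions a n))
              + 0 * real n ^ (length a - 2)"
        using few[OF L_def] \<open>m < L\<close> by (intro exI[of _ "12 * L"] exI[of _ "g L"] conjI) auto
    qed
  qed (use a r in \<open>auto simp: \<kappa>_def\<close>)
  then show ?thesis by (simp add: a_def)
qed

theorem corollary1p4:
  fixes r :: nat
  assumes "r \<ge> 3"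
  shows "(\<forall>(m :: nat) (a :: int list).
            m \<ge> 2 \<and> length a = 2 * m \<and> 0 \<notin> set a \<and> \<not> has_canceling_partition a
            \<longrightarrow> uncommon r a)
         \<and> uncommon r [1, 2, -1, -2]"
proof (intro conjI allI impI)
  fix m :: nat and a :: "int list"
  assume "m \<ge> 2 \<and> length a = 2 * m \<and> 0 \<notin> set a \<and> \<not> has_canceling_partition a"
  then show "uncommon r a"
    using assms by (intro uncommon_if_no_canceling_partition) auto
qed (use assms in \<open>auto intro!: uncommon_1_2 simp del: One_nat_def\<close>)

end
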